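(* Let $Q_\infty^\infty$ be the uniform infinite half-planar quadrangulation (UIHPQ) constructed from a uniform infinite treed bridge, let $\gamma_{\max}$ be its maximal geodesic started from the root vertex, and let $\mathcal R_+$, $\mathcal R_-$ be the sets of intersection times of $\gamma_{\max}$ with the right and left part of the boundary, respectively. Then for every $i\in\mathbb N$, $$\mathbb P(i\in\mathcal R_+)=\frac1{i+1}\qquad\text{and}\qquad\mathbb P(i\in\mathcal R_-)=\frac3{i+3}.$$ Also, almost surely, both $\mathcal R_+$ and $\mathcal R_-$ are infinite sets, and the maximal geodesic $\gamma_{\max}$ hits the left as well as the right part of the boundary infinitely many times. However, this happens with asymptotic frequency zero: almost surely $|\mathcal R_+|=0$ and $|\mathcal R_-|=0$, where $|\mathcal R|:=\lim_{n\to\infty}\frac1n\#(\mathcal R\cap\{1,\dots,n\})$.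
   Context: Notation: $\mathbb N=\{1,2,\dots\}$, $\mathbb Z_+=\{0,1,2,\dots\}$, $\mathbb Z_-=\{\dots,-2,-1,0\}$. **Uniform infinite treed bridge.** A well-labeled tree $(\tau,\ell)$ is a finite rooted plane tree $\tau$ with integer vertex labels $\ell$ such that labels of adjacent vertices differ by at most 1. For $k\in\mathbb Z$, $\rho_k$ is the probability measure on well-labeled trees with root label $k$ given by $\rho_k((\tau,\ell))=\tfrac12 12^{-|\tau|}$, $|\tau|$ the number of edges. Let $b=(b(i):i\in\mathbb Z)$ be a two-sided simple symmetric random walk with $b(0)=0$ (the sides $i\ge0$ and $i\le0$ are independent simple symmetric random walks from $0$). An index $i$ is a down-step if $b(i+1)=b(i)-1$; $DS(b)$ is the set of down-steps. Conditionally on $b$, let $T(i)$, $i\in DS(b)$, be independent well-labeled trees with $T(i)$ of law $\rho_{b(i)}$. **The UIHPQ.** Embed $\mathbb Z$ as a horizontal line with $i$ labeled $b(i)$, and for $i\in DS(b)$ graft $T(i)$ in the upper half-plane, identifying its root with the vertex $i$. Vertices of the trees $T(i)$ (including the roots $i\in DS(b)$) are called real. A real corner is a corner (angular sector between consecutive edges) in the upper half-plane incident to a real vertex. List the real corners in left-to-right (clockwise contour) order as $(c_n)_{n\in\mathbb Z}$, where $c_0$ is the leftmost real corner with label $0$ belonging to a tree $T(i)$ with $i\in DS(b)\cap\mathbb Z_+$; the label of a corner is the label of its vertex. The successor $\mathrm{succ}(c_n)$ is the first corner among $c_{n+1},c_{n+2},\dots$ with label $\ell(c_n)-1$ (it exists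 almost surely). The UIHPQ $Q_\infty^\infty$ is the infinite planar map whose vertices are the real vertices and whose edges are the arcs (drawn without crossings in the upper half-plane) joining $c_n$ to $\mathrm{succ}(c_n)$, for all $n\in\mathbb Z$. **Boundary.** Define $\varphi:\mathbb Z\to V(Q_\infty^\infty)$ by $\varphi(i)=i$ if $i\in DS(b)$, and otherwise $\varphi(i)$ is the vertex incident to the first real corner to the right of $i$ with label $b(i)$. The boundary vertices are $\varphi(\mathbb Z)$; $\varphi(\mathbb Z_-)$ and $\varphi(\mathbb Z_+)$ are the left and right parts of the boundary. The root vertex is $\varrho=\varphi(0)$, whose leftmost real corner is $c_0$. **Maximal geodesic.** Writing $\mathcal V(c)$ for the vertex incident to a corner $c$, the maximal geodesic from $\varrho$ is $\gamma_{\max}(0)=\varrho$, $\gamma_{\max}(i)=\mathcal V(\mathrm{succ}^{(i)}(c_0))$ for $i\in\mathbb N$ ($i$-fold iterate of the successor map). Set $$\mathcal R_+=\{j\in\mathbb Z_+:\gamma_{\max}(j)\in\varphi(\mathbb Z_+)\},\qquad\mathcal R_-=\{j\in\mathbb Z_+:\gamma_{\max}(j)\in\varphi(\mathbb Z_-)\}.$$ *)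

theory Defs
  imports "HOL-Probability.Probability"
begin

section \<open>Labeled plane trees\<close>

datatype ltree = LTree (root_label: int) (subtrees: "ltree list")

fun num_edges :: "ltree \<Rightarrow> nat" where
  "num_edges (LTree l ts) = (\<Sum>t\<leftarrow>ts. Suc (num_edges t))"

fun well_labeled :: "ltree \<Rightarrow> bool" where
  "well_labeled (LTree l ts) \<longleftrightarrow>
     (\<forall>t\<in>set ts. \<bar>root_label t - l\<bar> \<le> 1 \<and> well_labeled t)"

text \<open>A vertex of a tree is addressed by the list of child positions (counted from the left,
  starting at 0) on the path from the root to it.\<close>

fun label_at :: "ltree \<Rightarrow> nat list \<Rightarrow> int" where
  "label_at t [] = root_label t"
| "label_at t (k # p) = label_at (subtrees t ! k) p"

text \<open>The clockwise contour of a tree drawn in the upper half-plane with its root at the bottom.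
  A vertex with \<open>m\<close> children is listed \<open>m + 1\<close> times, once for each of its corners; for the root
  these are the corners in the upper half-plane, the horizontal line counting as its two outer
  edges.\<close>

fun contour :: "ltree \<Rightarrow> nat list list"
  and contour_forest :: "nat \<Rightarrow> ltree list \<Rightarrow> nat list list" where
  "contour (LTree l ts) = [] # contour_forest 0 ts"
| "contour_forest k [] = []"
| "contour_forest k (t # ts) = map ((#) k) (contour t) @ [] # contour_forest (Suc k) ts"

definition rho :: "int \<Rightarrow> ltree measure" where
  "rho k = point_measure UNIV
     (\<lambda>t. if well_labeled t \<and> root_label t = k then ennreal (1 / 2 * (1 / 12) ^ num_edges t) else 0)"


section \<open>The uniform infinite treed bridge\<close>

definition down_steps :: "(int \<Rightarrow> int) \<Rightarrow> int set" where
  "down_steps b = {i. b (i + 1) = b i - 1}"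

definition (in prob_space) simple_random_walk :: "(nat \<Rightarrow> 'a \<Rightarrow> int) \<Rightarrow> bool" where
  "simple_random_walk S \<longleftrightarrow>
     (\<forall>n. random_variable (count_space UNIV) (S n)) \<and>
     (\<forall>\<omega>\<in>space M. S 0 \<omega> = 0) \<and>
     indep_vars (\<lambda>_. count_space UNIV) (\<lambda>n \<omega>. S (Suc n) \<omega> - S n \<omega>) UNIV \<and>
     (\<forall>n. distr M (count_space UNIV) (\<lambda>\<omega>. S (Suc n) \<omega> - S n \<omega>)
            = measure_pmf (pmf_of_set {-1, 1}))"

text \<open>The tree \<open>T i\<close> is only meaningful where \<open>i\<close> is a down-step of the bridge; elsewhere its value is
  an unconstrained placeholder.\<close>

locale treed_bridge = prob_space M
  for M :: "'a measure" and b :: "int \<Rightarrow> 'a \<Rightarrow> int" and T :: "int \<Rightarrow> 'a \<Rightarrow> ltree" +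
  assumes walk_right: "simple_random_walk (\<lambda>n. b (int n))"
    and walk_left: "simple_random_walk (\<lambda>n. b (- int n))"
    and sides_indep:
      "indep_var (\<Pi>\<^sub>M n\<in>UNIV. count_space UNIV) (\<lambda>\<omega> n. b (int n) \<omega>)
                 (\<Pi>\<^sub>M n\<in>UNIV. count_space UNIV) (\<lambda>\<omega> n. b (- int n) \<omega>)"
    and tree_measurable: "random_variable (count_space UNIV) (T i)"
    and trees_cond_indep:
      "finite J \<Longrightarrow>
       AE \<omega> in M. J \<subseteq> down_steps (\<lambda>i. b i \<omega>) \<longrightarrow>
         real_cond_exp M
           (vimage_algebra (space M) (\<lambda>\<omega> i. b i \<omega>) (\<Pi>\<^sub>M i\<in>UNIV. count_space UNIV))
           (indicator {\<omega>\<in>space M. \<forall>j\<in>J. T j \<omega> \<in> A j}) \<omega>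
         = (\<Prod>j\<in>J. measure (rho (b j \<omega>)) (A j))"


section \<open>Real vertices and real corners\<close>

text \<open>From here on \<open>b\<close> and \<open>T\<close> denote one realization of the treed bridge. The vertex with address
  \<open>p\<close> in the tree grafted at \<open>i\<close> is \<open>(i, p)\<close>; in particular \<open>(i, [])\<close> is the point \<open>i\<close> of the line.\<close>

type_synonym vertex = "int \<times> nat list"

definition real_vertices :: "(int \<Rightarrow> int) \<Rightarrow> (int \<Rightarrow> ltree) \<Rightarrow> vertex set" where
  "real_vertices b T = {(i, p). i \<in> down_steps b \<and> p \<in> set (contour (T i))}"

text \<open>\<open>Corner i n\<close> is the corner met at step \<open>n\<close> of the contour of the tree grafted at \<open>i\<close>. The order
  on corners is the left-to-right one.\<close>

datatype corner = Corner (base: int) (step: nat)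

instantiation corner :: linorder
begin

definition less_corner :: "corner \<Rightarrow> corner \<Rightarrow> bool" where
  "c < c' \<longleftrightarrow> base c < base c' \<or> base c = base c' \<and> step c < step c'"

definition less_eq_corner :: "corner \<Rightarrow> corner \<Rightarrow> bool" where
  "c \<le> c' \<longleftrightarrow> c < c' \<or> c = (c' :: corner)"

instance
  by standard (auto simp: less_corner_def less_eq_corner_def intro: corner.expand)

end

definition real_corners :: "(int \<Rightarrow> int) \<Rightarrow> (int \<Rightarrow> ltree) \<Rightarrow> corner set" where
  "real_corners b T = {Corner i n | i n. i \<in> down_steps b \<and> n < length (contour (T i))}"

definition corner_vertex :: "(int \<Rightarrow> ltree) \<Rightarrow> corner \<Rightarrow> vertex" where
  "corner_vertex T c = (base c, contour (T (base c)) ! step c)"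

definition vertex_label :: "(int \<Rightarrow> ltree) \<Rightarrow> vertex \<Rightarrow> int" where
  "vertex_label T v = label_at (T (fst v)) (snd v)"

definition corner_label :: "(int \<Rightarrow> ltree) \<Rightarrow> corner \<Rightarrow> int" where
  "corner_label T c = vertex_label T (corner_vertex T c)"

definition root_corner :: "(int \<Rightarrow> int) \<Rightarrow> (int \<Rightarrow> ltree) \<Rightarrow> corner" where
  "root_corner b T = (LEAST c. c \<in> real_corners b T \<and> 0 \<le> base c \<and> corner_label T c = 0)"

definition succ_corner :: "(int \<Rightarrow> int) \<Rightarrow> (int \<Rightarrow> ltree) \<Rightarrow> corner \<Rightarrow> corner" where
  "succ_corner b T c =
     (LEAST c'. c' \<in> real_corners b T \<and> c < c' \<and> corner_label T c' = corner_label T c - 1)"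


section \<open>The map, its boundary and its maximal geodesic\<close>

text \<open>The vertices of the UIHPQ are the \<open>real_vertices\<close>, and it has one edge for each real corner,
  with the following end points (multiple edges are possible).\<close>

definition uihpq_edge :: "(int \<Rightarrow> int) \<Rightarrow> (int \<Rightarrow> ltree) \<Rightarrow> corner \<Rightarrow> vertex set" where
  "uihpq_edge b T c = {corner_vertex T c, corner_vertex T (succ_corner b T c)}"

definition boundary_vertex :: "(int \<Rightarrow> int) \<Rightarrow> (int \<Rightarrow> ltree) \<Rightarrow> int \<Rightarrow> vertex" where
  "boundary_vertex b T i =
     (if i \<in> down_steps b then (i, [])
      else corner_vertex T
             (LEAST c. c \<in> real_corners b T \<and> i < base c \<and> corner_label T c = b i))"

definition left_boundary :: "(int \<Rightarrow> int) \<Rightarrow> (int \<Rightarrow> ltree) \<Rightarrow> vertex set" where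
  "left_boundary b T = boundary_vertex b T ` {..0}"

definition right_boundary :: "(int \<Rightarrow> int) \<Rightarrow> (int \<Rightarrow> ltree) \<Rightarrow> vertex set" where
  "right_boundary b T = boundary_vertex b T ` {0..}"

definition max_geodesic :: "(int \<Rightarrow> int) \<Rightarrow> (int \<Rightarrow> ltree) \<Rightarrow> nat \<Rightarrow> vertex" where
  "max_geodesic b T j =
     (if j = 0 then boundary_vertex b T 0
      else corner_vertex T ((succ_corner b T ^^ j) (root_corner b T)))"

definition R_plus :: "(int \<Rightarrow> int) \<Rightarrow> (int \<Rightarrow> ltree) \<Rightarrow> nat set" where
  "R_plus b T = {j. max_geodesic b T j \<in> right_boundary b T}"

definition R_minus :: "(int \<Rightarrow> int) \<Rightarrow> (int \<Rightarrow> ltree) \<Rightarrow> nat set" where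
  "R_minus b T = {j. max_geodesic b T j \<in> left_boundary b T}"

definition has_frequency :: "nat set \<Rightarrow> real \<Rightarrow> bool" where
  "has_frequency R d \<longleftrightarrow> (\<lambda>n. 1 / real n * real (card (R \<inter> {1..n}))) \<longlonglongrightarrow> d"

end

theory Submission
  imports Defs
begin

text \<open>
  Labels decrease by at most 1 along the contour, so the maximal geodesic at time \<open>j\<close> sits at the
  first corner to the right of 0 with label \<open>- j\<close>. It is on the right (left) part of the boundary iff no
  tree grafted between 0 and the first point of the right (left) half of the bridge at height \<open>- j\<close>
  carries a label \<open>\<le> - j\<close>. A tree with root label \<open>k > 0\<close> has positive labels only with probability
  \<open>q k = k (k + 3) / ((k + 1) (k + 2))\<close>, and \<open>1 / (x + 1)\<close> resp. \<open>3 / (x + 3)\<close> solve the recursion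
  \<open>2 f x = f (x + 1) + q x * f (x - 1)\<close> resp. \<open>2 f x = q (x + 1) * f (x + 1) + f (x - 1)\<close> for the walk at
  height \<open>x\<close> above the target. By the Markov property the contact times form a renewal set with
  renewal probabilities \<open>f\<close>. As \<open>f\<close> is not summable the set is infinite; as \<open>f x\<close> is of order \<open>1 / x\<close>
  the expected number of points up to \<open>n\<close> is of order \<open>log n\<close>, and along powers of 2 this gives
  frequency 0.
\<close>

section \<open>Labelled trees\<close>

text \<open>The formula for \<open>q\<close> is the classical generating function of well-labeled
  trees with positive labels at the critical weight 1/12, normalised; it is verified, not derived.
  It solves a recursion of second order with the single boundary value \<open>q 0 = 0\<close>, so
  the equation alone does not identify the tree probability: iteration over the height places the
  probability below \<open>q\<close>, and boundedness then forces equality. The recursions for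
  \<open>f\<close> differ since a tree sits at the upper end of each down-step: read away from 0,
  the right walk meets it before stepping down from \<open>x\<close>, the left walk after stepping
  up to \<open>x + 1\<close>. Trees are independent only conditionally on the whole bridge. In place
  of stopping times, inclusion probabilities of several contact times at once come from sums over
  finite paths, weighted by the probabilities of their trees. The product of \<open>f\<close> over
  the remaining gaps is a martingale for these weights, and recurrence of the walk disposes of the
  paths that have not reached the last target.\<close>

fun contour_labels :: "ltree \<Rightarrow> int list" where
  "contour_labels (LTree l ts) = l # concat (map (\<lambda>t. contour_labels t @ [l]) ts)"

lemma set_contour_labels [simp]:
  "set (contour_labels (LTree l ts)) = insert l (\<Union>t\<in>set ts. set (contour_labels t))"
  by auto

declare contour_labels.simps [simp del]

definition labels_above :: "int \<Rightarrow> ltree set" where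
  "labels_above m = {t. \<forall>x\<in>set (contour_labels t). m < x}"

text \<open>Truncation at \<open>n\<close> generations of vertices makes the root decomposition an
  iteration that starts from the empty set, which selects the minimal solution of the resulting
  equation.\<close>

fun bounded_height :: "(int \<Rightarrow> bool) \<Rightarrow> nat \<Rightarrow> ltree set" where
  "bounded_height P 0 = {}"
| "bounded_height P (Suc n) =
     {LTree l ts | l ts. P l \<and> (\<forall>t\<in>set ts. t \<in> bounded_height P n \<and> \<bar>root_label t - l\<bar> \<le> 1)}"

lemma bounded_height_mono: "bounded_height P n \<subseteq> bounded_height P (Suc n)"
proof (induction n)
  case (Suc n)
  then show ?case by (auto simp: subset_iff)
qed simp

lemma bounded_height_le: "m \<le> n \<Longrightarrow> bounded_height P m \<subseteq> bounded_height P n"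
  using lift_Suc_mono_le[of "bounded_height P", OF bounded_height_mono] by blast

lemma bounded_height_sound:
  "t \<in> bounded_height P n \<Longrightarrow> well_labeled t \<and> (\<forall>x\<in>set (contour_labels t). P x)"
proof (induction n arbitrary: t)
  case (Suc n)
  then obtain l ts where t: "t = LTree l ts" "P l"
    "\<And>u. u \<in> set ts \<Longrightarrow> u \<in> bounded_height P n \<and> \<bar>root_label u - l\<bar> \<le> 1"
    by auto
  then show ?case using Suc.IH by auto
qed simp

lemma bounded_height_complete:
  "well_labeled t \<Longrightarrow> (\<forall>x\<in>set (contour_labels t). P x) \<Longrightarrow> \<exists>n. t \<in> bounded_height P n"
proof (induction t)
  case (LTree l ts)
  have "\<forall>t\<in>set ts. \<exists>n. t \<in> bounded_height P n"
  proof
    fix t assume t: "t \<in> set ts"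
    have "\<forall>x\<in>set (contour_labels t). P x" using LTree.prems(2) t by auto
    then show "\<exists>n. t \<in> bounded_height P n" using LTree.IH[OF t] LTree.prems(1) t by auto
  qed
  then obtain N where N: "\<And>t. t \<in> set ts \<Longrightarrow> t \<in> bounded_height P (N t)" by metis
  define n where "n = (\<Sum>t\<in>set ts. N t)"
  have "t \<in> bounded_height P n" if "t \<in> set ts" for t
    using N[OF that] bounded_height_le[of "N t" n P] member_le_sum[of t "set ts" N] that
    by (auto simp: n_def)
  then have "LTree l ts \<in> bounded_height P (Suc n)"
    using LTree.prems by auto
  then show ?case by blast
qed

section \<open>Masses of trees of bounded height\<close>

definition tree_weight :: "ltree \<Rightarrow> ennreal" where
  "tree_weight t = ennreal ((1 / 12) ^ num_edges t)"

lemma tree_weight_LTree: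
  "tree_weight (LTree l ts) = (\<Prod>t\<leftarrow>ts. ennreal (1 / 12) * tree_weight t)"
proof (induction ts)
  case (Cons t ts)
  have "tree_weight (LTree l (t # ts)) = ennreal (1 / 12 * (1 / 12) ^ num_edges t) * tree_weight (LTree l ts)"
    unfolding tree_weight_def
    by (subst ennreal_mult'[symmetric]) (simp_all add: power_add)
  also have "ennreal (1 / 12 * (1 / 12) ^ num_edges t) = ennreal (1 / 12) * tree_weight t"
    unfolding tree_weight_def by (rule ennreal_mult') simp
  finally show ?case by (simp only: Cons.IH list.map prod_list.Cons)
qed (simp add: tree_weight_def)

text \<open>Tonelli: splitting off the head of the list factors out one integral, so ordered
  families of \<open>r\<close> subtrees contribute an \<open>r\<close>-th power.\<close>

lemma nn_integral_lists_length:
  fixes g :: "'b \<Rightarrow> ennreal"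
  shows "(\<integral>\<^sup>+ts. (\<Prod>t\<leftarrow>ts. g t) * indicator {ts \<in> lists B. length ts = r} ts \<partial>count_space UNIV)
       = (\<integral>\<^sup>+t. g t * indicator B t \<partial>count_space UNIV) ^ r"
proof (induction r)
  case 0
  have "(\<integral>\<^sup>+ts. (\<Prod>t\<leftarrow>ts. g t) * indicator {ts \<in> lists B. length ts = 0} ts \<partial>count_space UNIV)
      = (\<integral>\<^sup>+ts. indicator {[] :: 'b list} ts \<partial>count_space UNIV)"
    by (intro nn_integral_cong) (auto simp: indicator_def)
  then show ?case by simp
next
  case (Suc r)
  let ?L = "\<lambda>r. {ts \<in> lists B. length ts = r}"
  let ?f = "\<lambda>ts. (\<Prod>t\<leftarrow>ts. g t)"
  have bij: "bij_betw (\<lambda>(t, ts). t # ts) (B \<times> ?L r) (?L (Suc r))"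
    by (rule bij_betw_byWitness[where f' = "\<lambda>ts. (hd ts, tl ts)"]) (auto simp: length_Suc_conv)
  have "(\<integral>\<^sup>+ts. ?f ts * indicator (?L (Suc r)) ts \<partial>count_space UNIV)
      = (\<integral>\<^sup>+ts. ?f ts \<partial>count_space (?L (Suc r)))"
    by (simp add: nn_integral_count_space_indicator)
  also have "\<dots> = (\<integral>\<^sup>+x. ?f (case x of (t, ts) \<Rightarrow> t # ts) \<partial>count_space (B \<times> ?L r))"
    by (rule nn_integral_bij_count_space[OF bij, symmetric])
  also have "\<dots> = (\<integral>\<^sup>+x. (case x of (t, ts) \<Rightarrow> (g t * indicator B t) * (?f ts * indicator (?L r) ts))
                    \<partial>count_space UNIV)"
    by (subst nn_integral_count_space_indicator)
       (auto intro!: nn_integral_cong simp: indicator_def)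
  also have "\<dots> = (\<integral>\<^sup>+t. \<integral>\<^sup>+ts. (g t * indicator B t) * (?f ts * indicator (?L r) ts)
                    \<partial>count_space UNIV \<partial>count_space UNIV)"
    by (subst nn_integral_fst_count_space[symmetric]) simp
  also have "\<dots> = (\<integral>\<^sup>+t. g t * indicator B t \<partial>count_space UNIV) ^ Suc r"
    by (simp add: nn_integral_cmult nn_integral_multc Suc.IH)
  finally show ?case .
qed

definition bounded_mass :: "(int \<Rightarrow> bool) \<Rightarrow> nat \<Rightarrow> int \<Rightarrow> ennreal" where
  "bounded_mass P n k =
     (\<integral>\<^sup>+t. tree_weight t * indicator {t \<in> bounded_height P n. root_label t = k} t \<partial>count_space UNIV)"

text \<open>A tree with root label \<open>k\<close> is a list of subtrees with root labels
  \<open>k - 1\<close>, \<open>k\<close> or \<open>k + 1\<close>. Sorting by the number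
  \<open>r\<close> of children gives a geometric series whose ratio carries 1/12 for the edge to
  each child.\<close>

lemma bounded_mass_Suc:
  assumes "P k"
  shows "bounded_mass P (Suc n) k =
    (\<Sum>r. (ennreal (1 / 12) * (bounded_mass P n (k - 1) + bounded_mass P n k + bounded_mass P n (k + 1))) ^ r)"
proof -
  define B where "B = {t \<in> bounded_height P n. \<bar>root_label t - k\<bar> \<le> 1}"
  let ?g = "\<lambda>t. ennreal (1 / 12) * tree_weight t"
  let ?f = "\<lambda>ts. (\<Prod>t\<leftarrow>ts. ?g t)"
  have set_eq: "{t \<in> bounded_height P (Suc n). root_label t = k} = LTree k ` lists B"
    using assms by (auto simp: B_def image_iff)
  have bij: "bij_betw (LTree k) (lists B) (LTree k ` lists B)"
    by (rule inj_on_imp_bij_betw) (simp add: inj_on_def)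
  have "bounded_mass P (Suc n) k = (\<integral>\<^sup>+t. tree_weight t \<partial>count_space (LTree k ` lists B))"
    unfolding bounded_mass_def set_eq by (simp add: nn_integral_count_space_indicator)
  also have "\<dots> = (\<integral>\<^sup>+ts. ?f ts \<partial>count_space (lists B))"
    by (subst nn_integral_bij_count_space[OF bij, symmetric]) (simp only: tree_weight_LTree)
  also have "\<dots> = (\<integral>\<^sup>+ts. ?f ts * indicator (lists B) ts \<partial>count_space UNIV)"
    by (simp add: nn_integral_count_space_indicator)
  also have "\<dots> = (\<integral>\<^sup>+ts. (\<Sum>r. ?f ts * indicator {ts \<in> lists B. length ts = r} ts) \<partial>count_space UNIV)"
  proof (rule nn_integral_cong)
    fix ts :: "ltree list"
    have "(\<Sum>r. ?f ts * indicator {ts \<in> lists B. length ts = r} ts)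
        = (\<Sum>r\<in>{length ts}. ?f ts * indicator {ts \<in> lists B. length ts = r} ts)"
      by (rule suminf_finite) auto
    then show "?f ts * indicator (lists B) ts = (\<Sum>r. ?f ts * indicator {ts \<in> lists B. length ts = r} ts)"
      by (simp add: indicator_def)
  qed
  also have "\<dots> = (\<Sum>r. \<integral>\<^sup>+ts. ?f ts * indicator {ts \<in> lists B. length ts = r} ts \<partial>count_space UNIV)"
    by (rule nn_integral_suminf) simp
  also have "\<dots> = (\<Sum>r. (\<integral>\<^sup>+t. ?g t * indicator B t \<partial>count_space UNIV) ^ r)"
    by (simp only: nn_integral_lists_length)
  also have "(\<integral>\<^sup>+t. ?g t * indicator B t \<partial>count_space UNIV)
    = (\<integral>\<^sup>+t. ennreal (1 / 12) *
        (tree_weight t * indicator {t \<in> bounded_height P n. root_label t = k - 1} t +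
         tree_weight t * indicator {t \<in> bounded_height P n. root_label t = k} t +
         tree_weight t * indicator {t \<in> bounded_height P n. root_label t = k + 1} t) \<partial>count_space UNIV)"
    by (intro nn_integral_cong) (auto simp: B_def indicator_def abs_le_iff)
  also have "\<dots> = ennreal (1 / 12) * (bounded_mass P n (k - 1) + bounded_mass P n k + bounded_mass P n (k + 1))"
    by (simp add: bounded_mass_def nn_integral_cmult nn_integral_add)
  finally show ?thesis .
qed

text \<open>Mass under \<open>rho k\<close> of the trees of height less than \<open>n\<close> whose labels satisfy \<open>P\<close>: with
  \<open>s\<close> the sum of the three neighbouring values, the geometric series over the number of children
  gives \<open>1/2 * 1/(1 - s/6) = 3/(6 - s)\<close>.\<close>

fun height_prob :: "(int \<Rightarrow> bool) \<Rightarrow> nat \<Rightarrow> int \<Rightarrow> real" where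
  "height_prob P 0 k = 0"
| "height_prob P (Suc n) k =
     (if P k then 3 / (6 - (height_prob P n (k - 1) + height_prob P n k + height_prob P n (k + 1))) else 0)"

lemma height_prob_bounds: "0 \<le> height_prob P n k \<and> height_prob P n k \<le> 1"
proof (induction n arbitrary: k)
  case (Suc n)
  from Suc.IH[of "k - 1"] Suc.IH[of k] Suc.IH[of "k + 1"] show ?case
    by (auto simp: field_simps)
qed simp

lemma bounded_mass_eq: "bounded_mass P n k = ennreal (2 * height_prob P n k)"
proof (induction n arbitrary: k)
  case 0
  then show ?case by (simp add: bounded_mass_def)
next
  case (Suc n)
  show ?case
  proof (cases "P k")
    case True
    define s where "s = height_prob P n (k - 1) + height_prob P n k + height_prob P n (k + 1)"
    have s: "0 \<le> s" "s \<le> 3"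
      using height_prob_bounds[of P n "k - 1"] height_prob_bounds[of P n k] height_prob_bounds[of P n "k + 1"]
      by (auto simp: s_def)
    have "ennreal (1 / 12) * (bounded_mass P n (k - 1) + bounded_mass P n k + bounded_mass P n (k + 1))
        = ennreal (s / 6)"
      using height_prob_bounds
      by (simp add: Suc.IH s_def ennreal_plus[symmetric] ennreal_mult'[symmetric] del: ennreal_plus)
    then have "bounded_mass P (Suc n) k = (\<Sum>r. ennreal ((s / 6) ^ r))"
      using s by (simp add: bounded_mass_Suc True ennreal_power)
    also have "\<dots> = ennreal (\<Sum>r. (s / 6) ^ r)"
      using s by (intro suminf_ennreal2) (auto intro!: summable_geometric)
    also have "(\<Sum>r. (s / 6) ^ r) = 1 / (1 - s / 6)"
      using s by (intro suminf_geometric) auto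
    also have "\<dots> = 2 * height_prob P (Suc n) k"
    proof -
      have "height_prob P (Suc n) k = 3 / (6 - s)" using True by (simp add: s_def)
      then show ?thesis using s by (simp add: field_simps)
    qed
    finally show ?thesis .
  next
    case False
    then have "{t \<in> bounded_height P (Suc n). root_label t = k} = {}" by auto
    then show ?thesis using False by (simp only: bounded_mass_def) simp
  qed
qed

text \<open>Monotone convergence along the truncation: every well-labeled tree is finite, hence
  appears at some height.\<close>

lemma height_prob_tendsto:
  "(\<lambda>n. height_prob P n k) \<longlonglongrightarrow> measure (rho k) {t. \<forall>x\<in>set (contour_labels t). P x}"
proof -
  let ?A = "{t. \<forall>x\<in>set (contour_labels t). P x}"
  define I where "I n t = ennreal (1 / 2) * (tree_weight t * indicator {t \<in> bounded_height P n. root_label t = k} t)"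
    for n t
  have inc: "incseq I"
    unfolding I_def using bounded_height_le
    by (auto simp: incseq_def le_fun_def indicator_def intro!: mult_left_mono)
  have sup: "(SUP n. I n t) =
      (if well_labeled t \<and> root_label t = k then ennreal (1 / 2 * (1 / 12) ^ num_edges t) else 0) * indicator ?A t"
    (is "_ = ?d t * _") for t
  proof (cases "well_labeled t \<and> root_label t = k \<and> t \<in> ?A")
    case True
    then obtain n where n: "t \<in> bounded_height P n" using bounded_height_complete by blast
    have "(SUP n. I n t) = ennreal (1 / 2 * (1 / 12) ^ num_edges t)"
    proof (rule antisym)
      show "(SUP n. I n t) \<le> ennreal (1 / 2 * (1 / 12) ^ num_edges t)"
      proof (rule SUP_least)
        fix m
        have "I m t \<le> ennreal (1 / 2) * tree_weight t"
          unfolding I_def by (intro mult_left_mono) (auto simp: indicator_def)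
        also have "\<dots> = ennreal (1 / 2 * (1 / 12) ^ num_edges t)"
          unfolding tree_weight_def by (rule ennreal_mult'[symmetric]) simp
        finally show "I m t \<le> ennreal (1 / 2 * (1 / 12) ^ num_edges t)" .
      qed
      have "ennreal (1 / 2 * (1 / 12) ^ num_edges t) = I n t"
        using True n by (simp only: I_def tree_weight_def ennreal_mult') (simp add: indicator_def)
      then show "ennreal (1 / 2 * (1 / 12) ^ num_edges t) \<le> (SUP n. I n t)"
        by (simp only:) (rule SUP_upper, simp)
    qed
    then show ?thesis using True by simp
  next
    case False
    then have "I n t = 0" for n
      using bounded_height_sound[of t P n] by (auto simp: I_def indicator_def)
    then show ?thesis using False by auto
  qed
  have int: "(\<integral>\<^sup>+t. I n t \<partial>count_space UNIV) = ennreal (height_prob P n k)" for n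
  proof -
    have "(\<integral>\<^sup>+t. I n t \<partial>count_space UNIV) = ennreal (1 / 2) * bounded_mass P n k"
      unfolding I_def bounded_mass_def by (rule nn_integral_cmult) simp
    also have "\<dots> = ennreal (1 / 2 * (2 * height_prob P n k))"
      unfolding bounded_mass_eq by (rule ennreal_mult'[symmetric]) simp
    finally show ?thesis by simp
  qed
  have "emeasure (rho k) ?A = (\<integral>\<^sup>+t. (SUP n. I n t) \<partial>count_space UNIV)"
    unfolding rho_def point_measure_def by (simp add: emeasure_density sup)
  also have "\<dots> = (SUP n. \<integral>\<^sup>+t. I n t \<partial>count_space UNIV)"
    by (rule nn_integral_monotone_convergence_SUP[OF inc]) simp
  also have "\<dots> = (SUP n. ennreal (height_prob P n k))"
    by (simp only: int)
  finally have em: "emeasure (rho k) ?A = (SUP n. ennreal (height_prob P n k))" .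
  have mono: "incseq (\<lambda>n. ennreal (height_prob P n k))"
    unfolding int[symmetric] using inc by (auto simp: incseq_def le_fun_def intro!: nn_integral_mono)
  have lim: "(\<lambda>n. ennreal (height_prob P n k)) \<longlonglongrightarrow> emeasure (rho k) ?A"
    unfolding em by (rule LIMSEQ_SUP[OF mono])
  have le1: "emeasure (rho k) ?A \<le> 1"
    unfolding em using height_prob_bounds by (auto intro!: SUP_least)
  then have "emeasure (rho k) ?A = ennreal (measure (rho k) ?A)"
    by (intro emeasure_eq_ennreal_measure) (auto simp: top_unique)
  with lim show "(\<lambda>n. height_prob P n k) \<longlonglongrightarrow> measure (rho k) ?A"
    using height_prob_bounds by (auto intro: tendsto_ennrealD simp: tendsto_ennreal_iff)
qed

text \<open>Without labels, \<open>rho k\<close> is the law of a critical geometric Galton-Watson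
  tree, whose height is less than \<open>n\<close> with probability \<open>n / (n + 1)\<close>. The
  total mass is therefore 1, and the density vanishes off the stated set.\<close>

lemma rho_well_labeled: "measure (rho k) {t. well_labeled t \<and> root_label t = k} = 1"
proof -
  have "height_prob (\<lambda>_. True) n j = real n / (real n + 1)" for n j
  proof (induction n arbitrary: j)
    case (Suc n)
    have "6 - (real n / (real n + 1) + real n / (real n + 1) + real n / (real n + 1))
        = 3 * (real n + 2) / (real n + 1)"
    proof -
      define y where "y = real n + 1"
      have "y \<noteq> 0" "real n = y - 1" by (auto simp: y_def)
      then show ?thesis by (simp add: field_simps)
    qed
    then have "height_prob (\<lambda>_. True) (Suc n) j = 3 / (3 * (real n + 2) / (real n + 1))"
      by (simp only: height_prob.simps Suc.IH if_True)
    also have "\<dots> = real (Suc n) / (real (Suc n) + 1)"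
      by (simp add: field_simps)
    finally show ?case .
  qed simp
  then have "(\<lambda>n. height_prob (\<lambda>_. True) n k) \<longlonglongrightarrow> 1"
    using LIMSEQ_n_over_Suc_n by (simp add: add.commute)
  then have "measure (rho k) UNIV = 1"
    using height_prob_tendsto[of "\<lambda>_. True" k] LIMSEQ_unique by auto
  moreover have "emeasure (rho k) {t. well_labeled t \<and> root_label t = k} = emeasure (rho k) UNIV"
    unfolding rho_def point_measure_def by (auto simp: emeasure_density indicator_def intro!: nn_integral_cong)
  ultimately show ?thesis by (simp add: measure_def)
qed

text \<open>Twice this value is the classical generating function, at weight 1/12 per edge, of
  well-labeled trees with positive labels and root label \<open>x\<close>. It vanishes at 0 and
  tends to 1.\<close>

definition positive_prob :: "int \<Rightarrow> real" where
  "positive_prob x = real_of_int x * (real_of_int x + 3) / ((real_of_int x + 1) * (real_of_int x + 2))"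

lemma positive_prob_bounds: "0 \<le> x \<Longrightarrow> 0 \<le> positive_prob x \<and> positive_prob x < 1"
proof -
  assume "0 \<le> x"
  then have "0 < (real_of_int x + 1) * (real_of_int x + 2)" by (intro mult_pos_pos) auto
  moreover have "real_of_int x * (real_of_int x + 3) < (real_of_int x + 1) * (real_of_int x + 2)"
    by (simp add: algebra_simps)
  ultimately show ?thesis using \<open>0 \<le> x\<close> by (simp add: positive_prob_def)
qed

text \<open>This is the recursion for \<open>height_prob\<close> in the limit, with its denominator
  cleared.\<close>

lemma positive_prob_fixpoint:
  assumes "1 \<le> x"
  shows "positive_prob x * (6 - (positive_prob (x - 1) + positive_prob x + positive_prob (x + 1))) = 3"
proof -
  define y where "y = real_of_int x"
  have y: "1 \<le> y" using assms by (simp add: y_def)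
  have "y \<noteq> 0" "y + 1 \<noteq> 0" "y + 2 \<noteq> 0" "y + 3 \<noteq> 0" using y by auto
  moreover have "positive_prob x = y * (y + 3) / ((y + 1) * (y + 2))"
      "positive_prob (x - 1) = (y - 1) * (y + 2) / (y * (y + 1))"
      "positive_prob (x + 1) = (y + 1) * (y + 4) / ((y + 2) * (y + 3))"
    by (simp_all add: positive_prob_def y_def algebra_simps)
  ultimately show ?thesis
    by (simp only:) (simp add: divide_simps, simp add: algebra_simps power2_eq_square)
qed

text \<open>The slopes of a convex sequence increase, and the first one is nonnegative here; a
  single positive slope would persist and force linear growth beyond \<open>C\<close>. This is the
  uniqueness principle both for the label equation and for the walk on the half-line.\<close>

lemma bounded_convex_zero:
  fixes d :: "nat \<Rightarrow> real"
  assumes "d 0 = 0" and nonneg: "\<And>n. 0 \<le> d n" and le: "\<And>n. d n \<le> C"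
    and convex: "\<And>n. 2 * d (Suc n) \<le> d n + d (Suc (Suc n))"
  shows "d n = 0"
proof (rule ccontr)
  assume "d n \<noteq> 0"
  have "0 \<le> d (Suc n) - d n" for n
  proof (induction n)
    case (Suc n)
    then show ?case using convex[of n] by simp
  qed (use assms(1) nonneg in auto)
  then have inc: "incseq d" by (intro incseq_SucI) (simp add: le_diff_eq)
  have "\<exists>m. 0 < d (Suc m) - d m"
  proof (rule ccontr)
    assume "\<nexists>m. 0 < d (Suc m) - d m"
    then have le0: "d (Suc m) \<le> d m" for m by (simp add: not_less)
    have "d m \<le> 0" for m by (induction m) (use assms(1) le0 order_trans in auto)
    then show False using \<open>d n \<noteq> 0\<close> nonneg[of n] by (simp add: antisym)
  qed
  then obtain m where m: "0 < d (Suc m) - d m" by blast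
  define e where "e = d (Suc m) - d m"
  have slope: "e \<le> d (Suc (m + k)) - d (m + k)" for k
  proof (induction k)
    case (Suc k)
    then show ?case using convex[of "m + k"] by simp
  qed (simp add: e_def)
  have grow: "real k * e \<le> d (m + k)" for k
  proof (induction k)
    case (Suc k)
    then show ?case using slope[of k] by (simp add: algebra_simps)
  qed (simp add: nonneg)
  obtain k where "C < real k * e" using m reals_Archimedean3[of e] by (auto simp: e_def)
  then show False using grow[of k] le[of "m + k"] by simp
qed

text \<open>\<open>positive_prob\<close> is a fixed point of a monotone map, so the iteration from 0
  stays below it, and so does its limit \<open>r\<close>. Both solve the same equation and vanish at
  level \<open>m\<close>; what remains is uniqueness.\<close>

lemma rho_labels_above:
  assumes "m \<le> k"
  shows "measure (rho k) (labels_above m) = positive_prob (k - m)"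
proof -
  let ?P = "\<lambda>l. m < l"
  define r where "r j = measure (rho j) (labels_above m)" for j
  have lim: "(\<lambda>n. height_prob ?P n j) \<longlonglongrightarrow> r j" for j
    unfolding r_def labels_above_def by (rule height_prob_tendsto)
  have le: "height_prob ?P n j \<le> positive_prob (j - m)" if "m \<le> j" for n j
    using that
  proof (induction n arbitrary: j)
    case 0
    then show ?case using positive_prob_bounds by simp
  next
    case (Suc n)
    show ?case
    proof (cases "m < j")
      case True
      define s where "s = positive_prob (j - 1 - m) + positive_prob (j - m) + positive_prob (j + 1 - m)"
      have "height_prob ?P n (j - 1) + height_prob ?P n j + height_prob ?P n (j + 1) \<le> s"
        unfolding s_def using Suc.IH[of "j - 1"] Suc.IH[of j] Suc.IH[of "j + 1"] True by simp
      moreover have "s < 3"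
        unfolding s_def using positive_prob_bounds[of "j - 1 - m"] positive_prob_bounds[of "j - m"]
          positive_prob_bounds[of "j + 1 - m"] True by simp
      ultimately have "height_prob ?P (Suc n) j \<le> 3 / (6 - s)"
        using True by (simp add: frac_le)
      also have "\<dots> = positive_prob (j - m)"
        using positive_prob_fixpoint[of "j - m"] True \<open>s < 3\<close>
        by (simp add: s_def field_simps)
      finally show ?thesis .
    qed (use Suc.prems positive_prob_bounds in auto)
  qed
  have r_le: "r j \<le> positive_prob (j - m)" if "m \<le> j" for j
    by (rule LIMSEQ_le_const2[OF lim]) (use le[OF that] in auto)
  have r_ge: "0 \<le> r j" for j by (simp add: r_def)
  have fix_r: "r j * (6 - (r (j - 1) + r j + r (j + 1))) = 3" if "m < j" for j
  proof -
    have "(\<lambda>n. height_prob ?P (Suc n) j * (6 - (height_prob ?P n (j - 1) + height_prob ?P n j + height_prob ?P n (j + 1))))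
        \<longlonglongrightarrow> r j * (6 - (r (j - 1) + r j + r (j + 1)))"
      by (intro tendsto_intros lim LIMSEQ_Suc)
    moreover have "height_prob ?P (Suc n) j * (6 - (height_prob ?P n (j - 1) + height_prob ?P n j + height_prob ?P n (j + 1))) = 3" for n
    proof -
      define D where "D = 6 - (height_prob ?P n (j - 1) + height_prob ?P n j + height_prob ?P n (j + 1))"
      have "D \<noteq> 0"
        using height_prob_bounds[of ?P n "j - 1"] height_prob_bounds[of ?P n j] height_prob_bounds[of ?P n "j + 1"]
        unfolding D_def by auto
      moreover have "height_prob ?P (Suc n) j = 3 / D" using that by (simp add: D_def)
      ultimately show ?thesis by (simp only: D_def[symmetric]) simp
    qed
    ultimately show ?thesis by (simp only: LIMSEQ_const_iff)
  qed
  \<comment> \<open>Both \<open>r\<close> and \<open>positive_prob\<close> solve the same fixed point equation; since they are at most 1, the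
    equation makes their difference convex.\<close>
  define d where "d n = positive_prob (int n) - r (m + int n)" for n
  have "d n = 0" for n
  proof (rule bounded_convex_zero)
    have "height_prob ?P n m = 0" for n by (cases n) auto
    then have "r m = 0" using lim[of m] by (simp add: LIMSEQ_const_iff)
    then show "d 0 = 0" by (simp add: d_def positive_prob_def)
    show "0 \<le> d n" for n using r_le[of "m + int n"] by (simp add: d_def)
    show "d n \<le> 1" for n using positive_prob_bounds[of "int n"] r_ge[of "m + int n"] by (simp add: d_def)
    show "2 * d (Suc n) \<le> d n + d (Suc (Suc n))" for n
    proof -
      define p r' s s' where "p = positive_prob (int n + 1)" and "r' = r (m + int n + 1)"
        and "s = positive_prob (int n) + p + positive_prob (int n + 2)"
        and "s' = r (m + int n) + r' + r (m + int n + 2)"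
      have p3: "p * (6 - s) = 3"
        using positive_prob_fixpoint[of "int n + 1"] by (simp add: p_def s_def add.commute)
      have r3: "r' * (6 - s') = 3"
      proof -
        have shift: "m + int n + 1 - 1 = m + int n" "m + int n + 1 + 1 = m + int n + 2" by simp_all
        show ?thesis using fix_r[of "m + int n + 1"] unfolding r'_def s'_def shift by simp
      qed
      have b: "0 \<le> p" "p < 1" "0 \<le> r'" "r' \<le> p"
        using positive_prob_bounds[of "int n + 1"] r_le[of "m + int n + 1"] r_ge
        by (auto simp: p_def r'_def)
      have "s \<le> 3" 
        using positive_prob_bounds[of "int n"] positive_prob_bounds[of "int n + 1"] positive_prob_bounds[of "int n + 2"]
        by (simp add: s_def p_def)
      have "s' \<le> s"
        using r_le[of "m + int n"] r_le[of "m + int n + 1"] r_le[of "m + int n + 2"]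
        by (simp add: s_def s'_def p_def r'_def)
      \<comment> \<open>Weighting the equation of \<open>r'\<close> by \<open>p\<close> and that of
        \<open>p\<close> by \<open>r'\<close> cancels the terms with 6. As
        \<open>p * r' \<le> 1\<close> and \<open>s' \<le> s\<close>, the right side is at most
        \<open>s - s'\<close>, which contains the middle difference once; this leaves convexity with
        factor 2.\<close>
      have "3 * (p - r') = p * r' * (s - s')"
      proof -
        have "3 * (p - r') = p * (r' * (6 - s')) - r' * (p * (6 - s))"
          unfolding p3 r3 by (simp add: algebra_simps)
        then show ?thesis by (simp add: algebra_simps)
      qed
      also have "\<dots> \<le> 1 * (s - s')"
        using b \<open>s' \<le> s\<close> by (intro mult_right_mono mult_le_one) auto
      finally have "3 * (p - r') \<le> s - s'" by simp
      moreover have "d n = positive_prob (int n) - r (m + int n)" "d (Suc n) = p - r'"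
          "d (Suc (Suc n)) = positive_prob (int n + 2) - r (m + int n + 2)"
        by (simp_all add: d_def p_def r'_def algebra_simps)
      ultimately show ?thesis by (simp add: s_def s'_def)
    qed
  qed
  from this[of "nat (k - m)"] assms show ?thesis by (simp add: d_def r_def)
qed

section \<open>Corners and contact times\<close>

text \<open>The list \<open>us\<close> of siblings already passed makes the child position
  \<open>k\<close> come out right in the recursion over a forest.\<close>

lemma map_label_at_contour_forest:
  "map (label_at t) (contour t) = contour_labels t"
  "length us = k \<Longrightarrow> map (label_at (LTree l (us @ ts))) (contour_forest k ts)
     = concat (map (\<lambda>t. contour_labels t @ [l]) ts)"
proof (induction t and k ts arbitrary: and us l rule: contour_contour_forest.induct)
  case (1 l ts)
  then show ?case using "1"[of "[]" l] by (simp add: contour_labels.simps)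
next
  case (3 k t ts)
  have "map (label_at (LTree l (us @ t # ts))) (map ((#) k) (contour t)) = map (label_at t) (contour t)"
    using 3(3) by (auto simp: nth_append)
  moreover have "map (label_at (LTree l ((us @ [t]) @ ts))) (contour_forest (Suc k) ts)
      = concat (map (\<lambda>t. contour_labels t @ [l]) ts)"
    by (rule 3(2)) (simp add: 3(3))
  ultimately show ?case using 3(1) by simp
qed simp

lemmas map_label_at_contour = map_label_at_contour_forest(1)

lemma length_contour: "length (contour t) = length (contour_labels t)"
  by (metis length_map map_label_at_contour)

lemma contour_labels_hd_last:
  "contour_labels t \<noteq> [] \<and> hd (contour_labels t) = root_label t \<and> last (contour_labels t) = root_label t"
proof (cases t)
  case (LTree l ts)
  then show ?thesis by (cases ts rule: rev_cases) (auto simp: contour_labels.simps)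
qed

lemma contour_labels_0: "contour_labels t ! 0 = root_label t" "0 < length (contour_labels t)"
  using contour_labels_hd_last[of t] by (auto simp: hd_conv_nth)

text \<open>The block of each child starts and ends at the label of that child, which differs from
  \<open>l\<close> by at most 1, so the junctions with the surrounding copies of \<open>l\<close>
  are harmless.\<close>

lemma successively_contour_labels:
  "well_labeled t \<Longrightarrow> successively (\<lambda>x y. \<bar>x - y\<bar> \<le> 1) (contour_labels t)"
proof (induction t)
  case (LTree l ts)
  have "successively (\<lambda>x y. \<bar>x - y\<bar> \<le> 1) (l # concat (map (\<lambda>t. contour_labels t @ [l]) us))"
    if "set us \<subseteq> set ts" for us
    using that
  proof (induction us)
    case (Cons u us)
    have "successively (\<lambda>x y. \<bar>x - y\<bar> \<le> 1) (contour_labels u)" "\<bar>root_label u - l\<bar> \<le> 1"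
      using LTree Cons.prems by auto
    then have "successively (\<lambda>x y. \<bar>x - y\<bar> \<le> 1)
        (([l] @ contour_labels u) @ (l # concat (map (\<lambda>t. contour_labels t @ [l]) us)))"
      using Cons contour_labels_hd_last[of u]
      by (subst successively_append_iff, subst successively_append_iff) (auto simp: abs_minus_commute)
    then show ?case by simp
  qed simp
  from this[of ts] show ?case by (simp add: contour_labels.simps)
qed

lemma contour_labels_step:
  assumes "well_labeled t" "Suc k < length (contour_labels t)"
  shows "contour_labels t ! k \<le> contour_labels t ! Suc k + 1"
proof -
  have "\<bar>contour_labels t ! k - contour_labels t ! Suc k\<bar> \<le> 1"
    using successively_contour_labels[OF assms(1)] assms(2) by (simp add: successively_conv_nth)
  then show ?thesis by simp
qed

text \<open>At the first index below \<open>l\<close> the predecessor is still at least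
  \<open>l\<close>, and a drop of at most 1 leaves only the value \<open>l\<close>.\<close>

lemma skip_free_crossing:
  fixes f :: "nat \<Rightarrow> int"
  assumes step: "\<And>k. k < n \<Longrightarrow> f k \<le> f (Suc k) + 1" and "f n < l" "l \<le> f 0"
  obtains k where "k < n" "f k = l" "f (Suc k) = l - 1"
proof -
  define m where "m = (LEAST k. f k < l)"
  have m: "f m < l" "m \<le> n" unfolding m_def using assms(2) by (auto intro: LeastI Least_le)
  have "m \<noteq> 0" using m(1) assms(3) by (metis not_less)
  then obtain k where k: "m = Suc k" by (cases m) auto
  have "\<not> f k < l" using not_less_Least[of k "\<lambda>k. f k < l"] k by (simp add: m_def)
  then show ?thesis using that[of k] step[of k] m k by auto
qed

lemma skip_free_hits:
  fixes f :: "nat \<Rightarrow> int"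
  assumes "\<And>k. k < n \<Longrightarrow> f k \<le> f (Suc k) + 1" "f n \<le> l" "l \<le> f 0"
  obtains k where "k \<le> n" "f k = l"
proof (cases "f n = l")
  case False
  then have "f n < l" using assms(2) by simp
  then obtain k where "k < n" "f k = l" using skip_free_crossing[of n f l] assms by blast
  then show ?thesis using that[of k] by simp
qed (use that in blast)

text \<open>Bases range over all integers, so the corner order is not well-founded and
  \<open>LEAST\<close> is meaningful only under a lower bound on bases. Minimising the base and then
  the step yields the least element.\<close>

lemma corner_Least:
  assumes "P c" and bound: "\<And>c. P c \<Longrightarrow> i \<le> base c"
  shows "P (LEAST c. P c)" "P c' \<Longrightarrow> (LEAST c. P c) \<le> c'"
proof -
  obtain c1 where c1: "P c1" "\<And>c. P c \<Longrightarrow> nat (base c1 - i) \<le> nat (base c - i)"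
    using ex_has_least_nat[of P c "\<lambda>c. nat (base c - i)"] assms(1) by auto
  obtain c2 where c2: "P c2 \<and> base c2 = base c1"
      "\<And>c. P c \<Longrightarrow> base c = base c1 \<Longrightarrow> step c2 \<le> step c"
    using ex_has_least_nat[of "\<lambda>c. P c \<and> base c = base c1" c1 step] c1(1) by auto
  have min: "c2 \<le> c" if "P c" for c
  proof -
    have "base c1 \<le> base c" using c1(2)[OF that] bound[OF that] bound[OF c1(1)] by auto
    then show ?thesis
      using c2(1) c2(2)[OF that] corner.expand[of c2 c]
      by (fastforce simp: less_eq_corner_def less_corner_def)
  qed
  have eq: "(LEAST c. P c) = c2" using c2(1) min by (intro Least_equality) auto
  show "P (LEAST c. P c)" "P c' \<Longrightarrow> (LEAST c. P c) \<le> c'" unfolding eq using c2(1) min by auto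
qed

lemma corner_less_base: "c \<le> c' \<Longrightarrow> base c \<le> base c'"
  by (auto simp: less_eq_corner_def less_corner_def)

text \<open>These are the almost sure properties of a realization from which the corner
  combinatorics follows; the arguments in this locale are free of probability.\<close>

locale regular_bridge =
  fixes b :: "int \<Rightarrow> int" and T :: "int \<Rightarrow> ltree"
  assumes bridge_0: "b 0 = 0"
    and bridge_step: "\<bar>b (i + 1) - b i\<bar> = 1"
    and tree_well_labeled: "i \<in> down_steps b \<Longrightarrow> well_labeled (T i)"
    and tree_root: "i \<in> down_steps b \<Longrightarrow> root_label (T i) = b i"
    and right_hits: "\<exists>n. b (int n) = - int m"
    and left_hits: "\<exists>n. b (- int n) = - int m"
begin

abbreviation "corners \<equiv> real_corners b T"
abbreviation "lab \<equiv> corner_label T"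

lemma corner_label_eq: "Corner i n \<in> corners \<Longrightarrow> lab (Corner i n) = contour_labels (T i) ! n"
  by (auto simp: real_corners_def corner_label_def vertex_label_def corner_vertex_def
      simp flip: map_label_at_contour)

lemma corner_cases:
  assumes "c \<in> corners"
  obtains i n where "c = Corner i n" "i \<in> down_steps b" "n < length (contour_labels (T i))"
    "lab c = contour_labels (T i) ! n"
  using assms corner_label_eq by (auto simp: real_corners_def length_contour)

lemma root_corner_mem:
  assumes "i \<in> down_steps b"
  shows "Corner i 0 \<in> corners" "lab (Corner i 0) = b i"
proof -
  show "Corner i 0 \<in> corners"
    using assms contour_labels_0(2) by (auto simp: real_corners_def length_contour)
  then show "lab (Corner i 0) = b i"
    using contour_labels_0(1) assms by (simp add: corner_label_eq tree_root)
qed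

lemma walk_crossing:
  assumes "i \<le> k" "b k < l" "l \<le> b i"
  obtains i' where "i \<le> i'" "i' < k" "b i' = l" "i' \<in> down_steps b"
proof -
  define f where "f n = b (i + int n)" for n
  have "f n \<le> f (Suc n) + 1" for n
    using bridge_step[of "i + int n"] by (simp add: f_def add_ac)
  moreover have "f (nat (k - i)) < l" "l \<le> f 0" using assms by (auto simp: f_def)
  ultimately obtain n where n: "n < nat (k - i)" "f n = l" "f (Suc n) = l - 1"
    using skip_free_crossing[of "nat (k - i)" f l] by blast
  then show ?thesis using that[of "i + int n"] by (simp add: f_def down_steps_def add_ac)
qed

text \<open>Reading the bridge from right to left turns an ascent into a descent.\<close>

lemma walk_crossing_up:
  assumes "i \<le> k" "b i \<le> l" "l \<le> b k"
  obtains i' where "i \<le> i'" "i' \<le> k" "b i' = l"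
proof -
  define f where "f n = b (k - int n)" for n
  have "f n \<le> f (Suc n) + 1" for n
    using bridge_step[of "k - int n - 1"] by (simp add: f_def algebra_simps)
  moreover have "f (nat (k - i)) \<le> l" "l \<le> f 0" using assms by (auto simp: f_def)
  ultimately obtain n where n: "n \<le> nat (k - i)" "f n = l"
    using skip_free_hits[of "nat (k - i)" f l] by blast
  then show ?thesis using that[of "k - int n"] assms by (auto simp: f_def)
qed

lemma bridge_ge: "- int n \<le> b (int n)"
proof (induction n)
  case (Suc n)
  then show ?case using bridge_step[of "int n"] by (simp add: add_ac)
qed (simp add: bridge_0)

lemma down_step_right:
  assumes "l \<le> b i"
  obtains i' where "i \<le> i'" "i' \<in> down_steps b" "b i' = l"
proof -
  \<comment> \<open>Since \<open>b (int n) \<ge> - int n\<close>, level \<open>- int m\<close> is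
    not reached before time \<open>m\<close>, hence only to the right of \<open>i\<close>; the
    summand 1 puts this level strictly below \<open>l\<close>, so a down-step at \<open>l\<close>
    lies in between.\<close>
  define m where "m = nat (\<bar>l\<bar> + \<bar>i\<bar> + 1)"
  obtain n where n: "b (int n) = - int m" using right_hits by blast
  then have "i \<le> int n" "b (int n) < l" using bridge_ge[of n] by (auto simp: m_def)
  then show ?thesis using walk_crossing[of i "int n" l] assms that by metis
qed

lemma tree_skip_free:
  assumes "i \<in> down_steps b" "x \<in> set (contour_labels (T i))" "x \<le> l" "l \<le> b i"
  shows "l \<in> set (contour_labels (T i))"
proof -
  let ?L = "contour_labels (T i)"
  obtain n where n: "n < length ?L" "?L ! n = x" using assms(2) by (auto simp: in_set_conv_nth)
  have "?L ! k \<le> ?L ! Suc k + 1" if "k < n" for k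
    using contour_labels_step[OF tree_well_labeled[OF assms(1)]] that n by simp
  then obtain k where "k \<le> n" "?L ! k = l"
    using skip_free_hits[of n "(!) ?L" l] n assms tree_root contour_labels_0 by metis
  then show ?thesis using n by (metis le_less_trans nth_mem)
qed

text \<open>If the root of the tree that carries \<open>c\<close> has label at least
  \<open>l\<close>, the contour of that tree up to \<open>c\<close> passes \<open>l\<close>.
  Otherwise the bridge has already crossed \<open>l\<close> at an earlier down-step, whose root
  corner is taken.\<close>

lemma corner_skip_free:
  assumes c: "c \<in> corners" and "i \<le> base c" "lab c \<le> l" "l \<le> b i"
  obtains c' where "c' \<in> corners" "i \<le> base c'" "c' \<le> c" "lab c' = l"
proof -
  from c obtain k n where k: "c = Corner k n" "k \<in> down_steps b" "n < length (contour_labels (T k))"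
    "lab c = contour_labels (T k) ! n" by (rule corner_cases)
  let ?L = "contour_labels (T k)"
  show ?thesis
  proof (cases "l \<le> b k")
    case True
    have "?L ! m \<le> ?L ! Suc m + 1" if "m < n" for m
      using contour_labels_step[OF tree_well_labeled[OF k(2)]] that k(3) by simp
    then obtain m where m: "m \<le> n" "?L ! m = l"
      using skip_free_hits[of n "(!) ?L" l] k assms True tree_root contour_labels_0 by metis
    have "Corner k m \<in> corners" using k m by (auto simp: real_corners_def length_contour)
    moreover have "Corner k m \<le> c"
      using m(1) k(1) by (auto simp: less_eq_corner_def less_corner_def)
    ultimately show ?thesis using that[of "Corner k m"] m k(1) assms(2) corner_label_eq by auto
  next
    case False
    obtain i' where i': "i \<le> i'" "i' < k" "b i' = l" "i' \<in> down_steps b"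
      using walk_crossing[of i k l] assms False k by (auto simp: not_le)
    then show ?thesis using that[of "Corner i' 0"] root_corner_mem[OF i'(4)] k
      by (auto simp: less_eq_corner_def less_corner_def)
  qed
qed

section \<open>Geodesic and boundary in terms of first corners\<close>

definition first_corner :: "nat \<Rightarrow> corner" where
  "first_corner j = (LEAST c. c \<in> corners \<and> 0 \<le> base c \<and> lab c = - int j)"

lemma first_corner:
  "first_corner j \<in> corners" "0 \<le> base (first_corner j)" "lab (first_corner j) = - int j"
  and first_corner_le:
    "c \<in> corners \<Longrightarrow> 0 \<le> base c \<Longrightarrow> lab c = - int j \<Longrightarrow> first_corner j \<le> c"
proof -
  let ?P = "\<lambda>c. c \<in> corners \<and> 0 \<le> base c \<and> lab c = - int j"
  obtain i where "0 \<le> i" "i \<in> down_steps b" "b i = - int j"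
    using down_step_right[of "- int j" 0] bridge_0 by auto
  then have P: "?P (Corner i 0)" using root_corner_mem by auto
  show "first_corner j \<in> corners" "0 \<le> base (first_corner j)" "lab (first_corner j) = - int j"
    using corner_Least(1)[of ?P, OF P, of 0] by (auto simp: first_corner_def)
  show "c \<in> corners \<Longrightarrow> 0 \<le> base c \<Longrightarrow> lab c = - int j \<Longrightarrow> first_corner j \<le> c"
    using corner_Least(2)[of ?P, OF P, of 0] by (auto simp: first_corner_def)
qed

text \<open>A corner of label \<open>- int (Suc j)\<close> to the right of 0 is preceded by one of
  label \<open>- int j\<close>, because the bridge starts at 0. So "right of
  \<open>first_corner j\<close>" and "right of 0" select the same candidates for the
  successor.\<close>

lemma succ_first_corner: "succ_corner b T (first_corner j) = first_corner (Suc j)"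
proof -
  have "(c \<in> corners \<and> first_corner j < c \<and> lab c = lab (first_corner j) - 1) \<longleftrightarrow>
      (c \<in> corners \<and> 0 \<le> base c \<and> lab c = - int (Suc j))" for c
  proof safe
    assume "first_corner j < c"
    then show "0 \<le> base c"
      using first_corner(2)[of j] corner_less_base[of "first_corner j" c] by (simp add: order_less_imp_le)
  next
    assume c: "c \<in> corners" "0 \<le> base c" "lab c = - int (Suc j)"
    obtain c' where c': "c' \<in> corners" "0 \<le> base c'" "c' \<le> c" "lab c' = - int j"
      using corner_skip_free[of c 0 "- int j"] c bridge_0 by auto
    then have "first_corner j \<le> c" using first_corner_le[of c' j] by simp
    then show "first_corner j < c" using c first_corner(3)[of j] by (auto simp: order_less_le)
  qed (simp_all add: first_corner(3))
  then show ?thesis unfolding succ_corner_def first_corner_def by simp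
qed

lemma max_geodesic_eq:
  assumes "0 < j"
  shows "max_geodesic b T j = corner_vertex T (first_corner j)"
proof -
  have "root_corner b T = first_corner 0" by (simp add: root_corner_def first_corner_def)
  then have "(succ_corner b T ^^ n) (root_corner b T) = first_corner n" for n
    by (induction n) (simp_all add: succ_first_corner)
  then show ?thesis using assms by (simp add: max_geodesic_def)
qed

abbreviation boundary_corner :: "int \<Rightarrow> corner" where
  "boundary_corner i \<equiv> (LEAST c. c \<in> corners \<and> i < base c \<and> lab c = b i)"

lemma boundary_corner:
  assumes "i \<notin> down_steps b"
  shows "boundary_corner i \<in> corners" "i < base (boundary_corner i)" "lab (boundary_corner i) = b i"
    and "c \<in> corners \<Longrightarrow> i < base c \<Longrightarrow> lab c = b i \<Longrightarrow> boundary_corner i \<le> c"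
proof -
  let ?P = "\<lambda>c. c \<in> corners \<and> i < base c \<and> lab c = b i"
  obtain i' where i': "i \<le> i'" "i' \<in> down_steps b" "b i' = b i"
    using down_step_right[of "b i" i] by auto
  then have "i < i'" using assms by (cases "i = i'") auto
  then have P: "?P (Corner i' 0)" using root_corner_mem i' by auto
  show "boundary_corner i \<in> corners" "i < base (boundary_corner i)" "lab (boundary_corner i) = b i"
    using corner_Least(1)[of ?P, OF P, of i] by auto
  show "c \<in> corners \<Longrightarrow> i < base c \<Longrightarrow> lab c = b i \<Longrightarrow> boundary_corner i \<le> c"
    using corner_Least(2)[of ?P, OF P, of i] by auto
qed

lemma boundary_vertex_props:
  "i \<le> fst (boundary_vertex b T i)" "vertex_label T (boundary_vertex b T i) = b i"
  "i \<in> down_steps b \<Longrightarrow> fst (boundary_vertex b T i) = i"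
  "i \<notin> down_steps b \<Longrightarrow> fst (boundary_vertex b T i) = base (boundary_corner i)"
  using boundary_corner[of i] tree_root[of i]
  by (cases "i \<in> down_steps b"; simp add: boundary_vertex_def corner_vertex_def corner_label_def vertex_label_def)+

lemma label_first_vertex: "vertex_label T (corner_vertex T (first_corner j)) = - int j"
  using first_corner(3)[of j] by (simp add: corner_label_def)

lemma fst_first_vertex: "fst (corner_vertex T (first_corner j)) = base (first_corner j)"
  by (simp add: corner_vertex_def)

lemma low_tree_corner:
  assumes "i \<in> down_steps b" "- int j < b i" "T i \<notin> labels_above (- int j)"
  obtains n where "Corner i n \<in> corners" "lab (Corner i n) = - int j"
proof -
  obtain x where "x \<in> set (contour_labels (T i))" "x \<le> - int j"
    using assms(3) by (auto simp: labels_above_def not_less)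
  then have "- int j \<in> set (contour_labels (T i))"
    using tree_skip_free[of i x "- int j"] assms by auto
  then obtain n where "n < length (contour_labels (T i))" "contour_labels (T i) ! n = - int j"
    by (auto simp: in_set_conv_nth)
  moreover from this have "Corner i n \<in> corners"
    using assms(1) by (auto simp: real_corners_def length_contour)
  ultimately show ?thesis using that[of n] corner_label_eq by auto
qed

lemma corner_in_high_tree:
  assumes "c \<in> corners" "lab c = - int j"
  shows "base c \<in> down_steps b" "T (base c) \<notin> labels_above (- int j)"
proof -
  from assms(1) obtain k n where k: "c = Corner k n" "k \<in> down_steps b" "n < length (contour_labels (T k))"
    "lab c = contour_labels (T k) ! n" by (rule corner_cases)
  then have "- int j \<in> set (contour_labels (T k))" using assms(2) nth_mem by fastforce
  then show "base c \<in> down_steps b" "T (base c) \<notin> labels_above (- int j)"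
    using k by (auto simp: labels_above_def)
qed

text \<open>A boundary index \<open>i\<close> of the vertex of \<open>first_corner j\<close> has
  label \<open>- j\<close> and lies weakly left of that corner. A tree at \<open>n\<close> with a
  label at most \<open>- j\<close>, met while the bridge is still above \<open>- j\<close>, would
  put the first corner, hence \<open>i\<close>, at or before \<open>n\<close>, a contradiction.
  Conversely, without such a tree the first corner defines the boundary vertex at the first hitting
  time \<open>H\<close>.\<close>

lemma R_plus_iff:
  assumes "0 < j"
  shows "j \<in> R_plus b T \<longleftrightarrow>
    (\<forall>n. int n \<in> down_steps b \<and> (\<forall>t\<le>n. - int j < b (int t)) \<longrightarrow> T (int n) \<in> labels_above (- int j))"
    (is "_ \<longleftrightarrow> ?R")
proof
  assume "j \<in> R_plus b T"
  then obtain i where i: "0 \<le> i" "corner_vertex T (first_corner j) = boundary_vertex b T i"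
    by (auto simp: R_plus_def right_boundary_def max_geodesic_eq[OF assms])
  have bi: "b i = - int j" using label_first_vertex[of j] boundary_vertex_props(2)[of i] i(2) by simp
  show ?R
  proof (intro allI impI, rule ccontr)
    fix n assume n: "int n \<in> down_steps b \<and> (\<forall>t\<le>n. - int j < b (int t))"
      "T (int n) \<notin> labels_above (- int j)"
    then obtain s where s: "Corner (int n) s \<in> corners" "lab (Corner (int n) s) = - int j"
      using low_tree_corner[of "int n" j] by blast
    then have "base (first_corner j) \<le> int n"
      using first_corner_le[of "Corner (int n) s" j] corner_less_base by fastforce
    moreover have "i \<le> base (first_corner j)"
      using boundary_vertex_props(1)[of i] i(2) fst_first_vertex[of j] by simp
    ultimately have "nat i \<le> n" using i(1) by simp
    then show False using n(1) bi i(1) by fastforce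
  qed
next
  assume R: ?R
  define H where "H = (LEAST n. b (int n) = - int j)"
  have H: "b (int H) = - int j" unfolding H_def using right_hits[of j] by (rule LeastI_ex)
  have before: "- int j < b (int t)" if "t < H" for t
  proof (rule ccontr)
    assume "\<not> - int j < b (int t)"
    then obtain i where "0 \<le> i" "i \<le> int t" "b i = - int j"
    proof (cases "b (int t) = - int j")
      case False
      then have "b (int t) < - int j" using \<open>\<not> - int j < b (int t)\<close> by simp
      then obtain i where "0 \<le> i" "i < int t" "b i = - int j"
        using walk_crossing[of 0 "int t" "- int j"] bridge_0 by auto
      then show ?thesis using that[of i] by simp
    qed (use that[of "int t"] in simp)
    moreover from this have "nat i < H" using that by linarith
    ultimately show False
      using not_less_Least[of "nat i" "\<lambda>n. b (int n) = - int j"] unfolding H_def by simp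
  qed
  have base_ge: "int H \<le> base c" if "c \<in> corners" "0 \<le> base c" "lab c = - int j" for c
  proof (rule ccontr)
    assume "\<not> int H \<le> base c"
    then have "\<forall>t\<le>nat (base c). - int j < b (int t)" using before that(2) by auto
    then have "T (base c) \<in> labels_above (- int j)"
      using R[rule_format, of "nat (base c)"] corner_in_high_tree(1)[OF that(1,3)] that(2) by auto
    then show False using corner_in_high_tree(2)[OF that(1,3)] by simp
  qed
  have "corner_vertex T (first_corner j) = boundary_vertex b T (int H)"
  \<comment> \<open>At a down-step the root corner of the tree at \<open>H\<close> comes first;
    otherwise no tree is grafted at \<open>H\<close>, and the two minima range over the same
    corners.\<close>
  proof (cases "int H \<in> down_steps b")
    case True
    have "first_corner j \<le> Corner (int H) 0"
      using first_corner_le[of "Corner (int H) 0" j] root_corner_mem[OF True] H by simp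
    moreover have "int H \<le> base (first_corner j)" using base_ge first_corner by blast
    ultimately have "first_corner j = Corner (int H) 0"
      by (cases "first_corner j") (auto simp: less_eq_corner_def less_corner_def)
    moreover have "contour (T (int H)) ! 0 = []" by (cases "T (int H)") simp
    ultimately show ?thesis using True by (simp add: corner_vertex_def boundary_vertex_def)
  next
    case False
    have "(c \<in> corners \<and> 0 \<le> base c \<and> lab c = - int j) \<longleftrightarrow>
        (c \<in> corners \<and> int H < base c \<and> lab c = b (int H))" for c
      using base_ge[of c] corner_in_high_tree(1)[of c j] False H by (cases "base c = int H") auto
    then show ?thesis using False by (simp add: boundary_vertex_def first_corner_def)
  qed
  then show "j \<in> R_plus b T"
    by (auto simp: R_plus_def right_boundary_def max_geodesic_eq[OF assms])
qed

text \<open>The geodesic never goes left of 0, so a contact on the left needs an index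
  \<open>i < 0\<close> without a tree whose boundary corner lies at or beyond 0: there may be no
  corner of label \<open>- j\<close> in between. The trees concerned stand at
  \<open>- int n - 1\<close>, the far end of the step out of \<open>- int n\<close>.\<close>

lemma R_minus_iff:
  assumes "0 < j"
  shows "j \<in> R_minus b T \<longleftrightarrow>
    (\<forall>n. - int n - 1 \<in> down_steps b \<and> (\<forall>t\<le>n. - int j < b (- int t)) \<longrightarrow>
         T (- int n - 1) \<in> labels_above (- int j))"
    (is "_ \<longleftrightarrow> ?R")
proof
  assume "j \<in> R_minus b T"
  then obtain i where i: "i \<le> 0" "corner_vertex T (first_corner j) = boundary_vertex b T i"
    by (auto simp: R_minus_def left_boundary_def max_geodesic_eq[OF assms])
  have bi: "b i = - int j" using label_first_vertex[of j] boundary_vertex_props(2)[of i] i(2) by simp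
  then have "i < 0" using i(1) assms bridge_0 by (cases "i = 0") auto
  have base_fst: "fst (boundary_vertex b T i) = base (first_corner j)"
    using i(2) fst_first_vertex[of j] by simp
  have not_down: "i \<notin> down_steps b"
    using boundary_vertex_props(3)[of i] base_fst first_corner(2)[of j] \<open>i < 0\<close> by auto
  show ?R
  proof (intro allI impI, rule ccontr)
    fix n assume n: "- int n - 1 \<in> down_steps b \<and> (\<forall>t\<le>n. - int j < b (- int t))"
      "T (- int n - 1) \<notin> labels_above (- int j)"
    \<comment> \<open>The down-step from \<open>- int n - 1\<close> to \<open>- int n\<close> starts
      one higher, so the condition up to time \<open>n\<close> also covers the point that carries
      the tree.\<close>
    have up: "- int j < b (- int n - 1)"
      using n(1) by (auto simp: down_steps_def)
    have "i < - int n - 1"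
    proof (rule ccontr)
      assume "\<not> i < - int n - 1"
      then have "i = - int n - 1 \<or> nat (- i) \<le> n" by linarith
      then show False using n(1) up bi i(1) by fastforce
    qed
    moreover obtain s where s: "Corner (- int n - 1) s \<in> corners" "lab (Corner (- int n - 1) s) = - int j"
      using low_tree_corner[of "- int n - 1" j] n up by blast
    ultimately have "boundary_corner i \<le> Corner (- int n - 1) s"
      using boundary_corner(4)[OF not_down] bi by simp
    then have "base (boundary_corner i) < 0" using corner_less_base by fastforce
    then show False using boundary_vertex_props(4)[OF not_down] base_fst first_corner(2)[of j] by simp
  qed
next
  assume R: ?R
  define G where "G = (LEAST n. b (- int n) = - int j)"
  have G: "b (- int G) = - int j" unfolding G_def using left_hits[of j] by (rule LeastI_ex)
  then have "0 < G" using assms bridge_0 by (cases G) auto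
  have after: "- int j < b (- int t)" if "t < G" for t
  proof (rule ccontr)
    assume "\<not> - int j < b (- int t)"
    then obtain i where "- int t \<le> i" "i \<le> 0" "b i = - int j"
      using walk_crossing_up[of "- int t" 0 "- int j"] bridge_0 by auto
    moreover from this have "nat (- i) < G" using that by linarith
    ultimately show False
      using not_less_Least[of "nat (- i)" "\<lambda>n. b (- int n) = - int j"] unfolding G_def by simp
  qed
  \<comment> \<open>The first visit to \<open>- j\<close> on the way left comes from above, so read
    from left to right the step out of \<open>- int G\<close> goes up.\<close>
  have not_down: "- int G \<notin> down_steps b"
    using after[of "G - 1"] \<open>0 < G\<close> G by (auto simp: down_steps_def of_nat_diff)
  have base_ge: "0 \<le> base c" if "c \<in> corners" "- int G < base c" "lab c = - int j" for c
  proof (rule ccontr)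
    assume "\<not> 0 \<le> base c"
    define n where "n = nat (- base c - 1)"
    have n: "base c = - int n - 1" "n < G" using \<open>\<not> 0 \<le> base c\<close> that(2) by (auto simp: n_def)
    then have "T (base c) \<in> labels_above (- int j)"
      using R[rule_format, of n] corner_in_high_tree(1)[OF that(1,3)] after by auto
    then show False using corner_in_high_tree(2)[OF that(1,3)] by simp
  qed
  have "(c \<in> corners \<and> 0 \<le> base c \<and> lab c = - int j) \<longleftrightarrow>
      (c \<in> corners \<and> - int G < base c \<and> lab c = b (- int G))" for c
    using base_ge[of c] \<open>0 < G\<close> G by auto
  then have "corner_vertex T (first_corner j) = boundary_vertex b T (- int G)"
    using not_down by (simp add: boundary_vertex_def first_corner_def)
  then show "j \<in> R_minus b T"
    by (auto simp: R_minus_def left_boundary_def max_geodesic_eq[OF assms])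
qed

end

section \<open>Renewal sets\<close>

text \<open>The probability that a renewal process with renewal probabilities \<open>f\<close> and a
  renewal at \<open>k\<close> hits every point of an increasing list.\<close>

fun gap_prod :: "(int \<Rightarrow> real) \<Rightarrow> int \<Rightarrow> nat list \<Rightarrow> real" where
  "gap_prod f k [] = 1"
| "gap_prod f k (j # js) = f (int j - k) * gap_prod f (int j) js"

lemma gap_prod_shift: "gap_prod f (k + int d) (map ((+) d) js) = gap_prod f k js"
proof (induction js arbitrary: k)
  case (Cons j js)
  show ?case using Cons.IH[of "int j"] by (simp add: add.commute)
qed simp

lemma sorted_list_of_set_shift:
  fixes d :: nat
  assumes "finite S" "0 \<notin> S"
  shows "sorted_list_of_set (insert d ((+) d ` S)) = d # map ((+) d) (sorted_list_of_set S)"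
proof (rule sorted_distinct_set_unique)
  have "sorted (map ((+) d) (sorted_list_of_set S))"
    unfolding sorted_map by (rule sorted_wrt_mono_rel[OF _ sorted_sorted_list_of_set]) simp
  then show "sorted (d # map ((+) d) (sorted_list_of_set S))" by auto
  show "distinct (d # map ((+) d) (sorted_list_of_set S))"
    using assms by (auto simp: distinct_map)
  show "set (sorted_list_of_set (insert d ((+) d ` S))) = set (d # map ((+) d) (sorted_list_of_set S))"
    using assms by (simp del: sorted_list_of_set_insert_remove)
qed simp_all

text \<open>Only inclusion probabilities are prescribed; they determine all cylinder probabilities
  at positive times. Time 0 is left out and acts as the origin of the first gap.\<close>

locale renewal_set = prob_space +
  fixes R :: "'a \<Rightarrow> nat set" and f :: "int \<Rightarrow> real"
  assumes measurable_mem: "{\<omega> \<in> space M. j \<in> R \<omega>} \<in> events"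
    and law: "sorted_wrt (<) js \<Longrightarrow> 0 \<notin> set js \<Longrightarrow> prob {\<omega> \<in> space M. set js \<subseteq> R \<omega>} = gap_prod f 0 js"
begin

lemma measurable_pattern: 
  assumes "countable S" "countable B"
  shows "{\<omega> \<in> space M. S \<subseteq> R \<omega> \<and> B \<inter> R \<omega> = {}} \<in> events"
proof -
  have [measurable]: "Measurable.pred M (\<lambda>\<omega>. j \<in> R \<omega>)" for j
    using measurable_mem[of j] by (simp add: pred_def)
  have "{\<omega> \<in> space M. S \<subseteq> R \<omega> \<and> B \<inter> R \<omega> = {}} =
      {\<omega> \<in> space M. (\<forall>j\<in>S. j \<in> R \<omega>) \<and> (\<forall>j\<in>B. j \<notin> R \<omega>)}" by auto
  also have "\<dots> \<in> events" using assms by measurable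
  finally show ?thesis .
qed

text \<open>One step of inclusion-exclusion: both terms on the right have one exclusion fewer, which
  leads down to pure inclusion events.\<close>

lemma pattern_split:
  assumes "finite S" "finite B"
  shows "prob {\<omega> \<in> space M. S \<subseteq> R \<omega> \<and> insert x B \<inter> R \<omega> = {}} =
    prob {\<omega> \<in> space M. S \<subseteq> R \<omega> \<and> B \<inter> R \<omega> = {}}
    - prob {\<omega> \<in> space M. insert x S \<subseteq> R \<omega> \<and> B \<inter> R \<omega> = {}}"
proof -
  have "prob ({\<omega> \<in> space M. S \<subseteq> R \<omega> \<and> insert x B \<inter> R \<omega> = {}} \<union>
         {\<omega> \<in> space M. insert x S \<subseteq> R \<omega> \<and> B \<inter> R \<omega> = {}}) =
      prob {\<omega> \<in> space M. S \<subseteq> R \<omega> \<and> insert x B \<inter> R \<omega> = {}} +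
      prob {\<omega> \<in> space M. insert x S \<subseteq> R \<omega> \<and> B \<inter> R \<omega> = {}}"
    using assms by (intro finite_measure_Union measurable_pattern) (auto simp: countable_finite)
  also have "{\<omega> \<in> space M. S \<subseteq> R \<omega> \<and> insert x B \<inter> R \<omega> = {}} \<union>
         {\<omega> \<in> space M. insert x S \<subseteq> R \<omega> \<and> B \<inter> R \<omega> = {}} =
      {\<omega> \<in> space M. S \<subseteq> R \<omega> \<and> B \<inter> R \<omega> = {}}" by auto
  finally show ?thesis by simp
qed

lemma law_set:
  assumes "finite S" "0 \<notin> S"
  shows "prob {\<omega> \<in> space M. S \<subseteq> R \<omega>} = gap_prod f 0 (sorted_list_of_set S)"
  using law[of "sorted_list_of_set S"] assms by simp

text \<open>The set forgets its past at each of its points; inclusion-exclusion extends this from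
  the events \<open>S \<subseteq> R\<close> to all cylinder events.\<close>

lemma renewal:
  assumes "finite B" "finite S" "0 \<notin> S" "0 \<notin> B" "0 < j"
  shows "prob {\<omega> \<in> space M. insert j ((+) j ` S) \<subseteq> R \<omega> \<and> (+) j ` B \<inter> R \<omega> = {}}
    = f (int j) * prob {\<omega> \<in> space M. S \<subseteq> R \<omega> \<and> B \<inter> R \<omega> = {}}"
  using assms
proof (induction B arbitrary: S)
  case empty
  have "gap_prod f 0 (sorted_list_of_set (insert j ((+) j ` S)))
      = f (int j) * gap_prod f 0 (sorted_list_of_set S)"
    using empty gap_prod_shift[of f 0 j]
    by (simp add: sorted_list_of_set_shift del: sorted_list_of_set_insert_remove)
  moreover have "finite (insert j ((+) j ` S))" "0 \<notin> insert j ((+) j ` S)" using empty by auto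
  ultimately have "prob {\<omega> \<in> space M. insert j ((+) j ` S) \<subseteq> R \<omega>}
      = f (int j) * prob {\<omega> \<in> space M. S \<subseteq> R \<omega>}"
    using law_set[of "insert j ((+) j ` S)"] law_set[of S] empty by metis
  then show ?case by simp
next
  case (insert x B)
  have img: "(+) j ` insert x B = insert (j + x) ((+) j ` B)"
    "insert (j + x) (insert j ((+) j ` S)) = insert j ((+) j ` insert x S)" by auto
  have "prob {\<omega> \<in> space M. insert j ((+) j ` S) \<subseteq> R \<omega> \<and> (+) j ` insert x B \<inter> R \<omega> = {}}
      = f (int j) * prob {\<omega> \<in> space M. S \<subseteq> R \<omega> \<and> B \<inter> R \<omega> = {}}
      - f (int j) * prob {\<omega> \<in> space M. insert x S \<subseteq> R \<omega> \<and> B \<inter> R \<omega> = {}}"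
    unfolding img(1) using insert.hyps insert.prems
    by (subst pattern_split) (simp_all add: insert.IH img(2) del: image_insert insert_subset)
  then show ?case
    using insert.hyps insert.prems by (simp only: pattern_split) (simp add: algebra_simps)
qed

section \<open>Last point before a given time, and infinitude\<close>

definition avoid_prob :: "nat \<Rightarrow> real" where
  "avoid_prob n = prob {\<omega> \<in> space M. {1..n} \<inter> R \<omega> = {}}"

lemma avoid_prob_antimono: "m \<le> n \<Longrightarrow> avoid_prob n \<le> avoid_prob m"
  unfolding avoid_prob_def
proof (rule finite_measure_mono)
  assume "m \<le> n"
  then have "{1..m} \<subseteq> {1..n}" by simp
  then show "{\<omega> \<in> space M. {1..n} \<inter> R \<omega> = {}} \<subseteq> {\<omega> \<in> space M. {1..m} \<inter> R \<omega> = {}}" by blast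
  show "{\<omega> \<in> space M. {1..m} \<inter> R \<omega> = {}} \<in> events" using measurable_pattern[of "{}" "{1..m}"] by simp
qed

lemma last_before:
  assumes "0 < j"
  shows "prob {\<omega> \<in> space M. j \<in> R \<omega> \<and> {j<..j + n} \<inter> R \<omega> = {}} = f (int j) * avoid_prob n"
proof -
  have "(+) j ` {1..n} = {j<..j + n}"
    by (simp add: image_add_atLeastAtMost atLeastSucAtMost_greaterThanAtMost[symmetric])
  then show ?thesis using renewal[of "{1..n}" "{}" j] assms by (simp add: avoid_prob_def)
qed

text \<open>The events that \<open>j\<close> is the last point up to \<open>n\<close> are disjoint
  for different \<open>j\<close>.\<close>

lemma sum_avoid_prob_le: "(\<Sum>j=1..n. f (int j) * avoid_prob (n - j)) \<le> 1"
proof -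
  let ?A = "\<lambda>j. {\<omega> \<in> space M. j \<in> R \<omega> \<and> {j<..n} \<inter> R \<omega> = {}}"
  have "(\<Sum>j=1..n. f (int j) * avoid_prob (n - j)) = (\<Sum>j=1..n. prob (?A j))"
  proof (rule sum.cong)
    fix j assume "j \<in> {1..n}"
    then show "f (int j) * avoid_prob (n - j) = prob (?A j)"
      using last_before[of j "n - j"] by simp
  qed simp
  also have "\<dots> = prob (\<Union>j\<in>{1..n}. ?A j)"
  proof (rule finite_measure_finite_Union[symmetric])
    show "?A ` {1..n} \<subseteq> events" using measurable_pattern[of "{_}"] by auto
    show "disjoint_family_on ?A {1..n}"
      unfolding disjoint_family_on_def
    proof (intro ballI impI)
      fix i j assume "i \<in> {1..n}" "j \<in> {1..n}" "i \<noteq> j"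
      then show "?A i \<inter> ?A j = {}" by (cases "i < j") (fastforce simp: disjoint_iff)+
    qed
  qed simp
  finally show ?thesis by simp
qed

context
  assumes f_nonneg: "\<And>j. 0 < j \<Longrightarrow> 0 \<le> f (int j)"
    and f_not_summable: "\<not> summable (\<lambda>j. f (int j))"
begin

text \<open>If the tail of the first gap stayed above some \<open>s > 0\<close>, the decomposition
  by the last point would bound all partial sums of \<open>f\<close> by
  \<open>1 / s\<close>.\<close>

lemma avoid_prob_tendsto_0: "avoid_prob \<longlonglongrightarrow> 0"
proof -
  obtain s where s: "avoid_prob \<longlonglongrightarrow> s" "\<And>n. s \<le> avoid_prob n"
    using decseq_convergent[of avoid_prob 0] avoid_prob_antimono
    by (auto simp: decseq_def avoid_prob_def)
  have "0 \<le> s" by (rule LIMSEQ_le_const[OF s(1)]) (auto simp: avoid_prob_def)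
  have "s = 0"
  proof (rule ccontr)
    assume "s \<noteq> 0"
    with \<open>0 \<le> s\<close> have "0 < s" by simp
    have bound: "(\<Sum>j=1..n. f (int j)) \<le> 1 / s" for n
    proof -
      have "(\<Sum>j=1..n. f (int j)) * s = (\<Sum>j=1..n. f (int j) * s)" by (simp add: sum_distrib_right)
      also have "\<dots> \<le> (\<Sum>j=1..n. f (int j) * avoid_prob (n - j))"
        using s(2) f_nonneg by (intro sum_mono mult_left_mono) auto
      also have "\<dots> \<le> 1" by (rule sum_avoid_prob_le)
      finally show ?thesis using \<open>0 < s\<close> by (simp add: field_simps)
    qed
    have "summable (\<lambda>j. f (int (Suc j)))"
    proof (rule bounded_imp_summable)
      fix n
      show "(\<Sum>j\<le>n. f (int (Suc j))) \<le> 1 / s"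
        using bound[of "Suc n"] sum.atLeast1_atMost_eq[of "\<lambda>j. f (int j)" "Suc n"]
        by (simp add: lessThan_Suc_atMost)
    qed (rule f_nonneg, simp)
    then show False using f_not_summable summable_Suc_iff[of "\<lambda>j. f (int j)"] by simp
  qed
  then show ?thesis using s by simp
qed

text \<open>A finite set has either a last positive point or no positive point at all. Each
  alternative has probability at most a constant times \<open>avoid_prob n\<close> for all
  \<open>n\<close>, hence 0, and there are only countably many.\<close>

lemma AE_infinite: "AE \<omega> in M. infinite (R \<omega>)"
proof -
  have zero: "prob {\<omega> \<in> space M. j \<in> R \<omega> \<and> {j<..} \<inter> R \<omega> = {}} = 0" if "0 < j" for j
  proof -
    have "prob {\<omega> \<in> space M. j \<in> R \<omega> \<and> {j<..} \<inter> R \<omega> = {}} \<le> f (int j) * avoid_prob n" for n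
      unfolding last_before[OF that, symmetric] using measurable_pattern[of "{j}" "{j<..j + n}"]
      by (intro finite_measure_mono) auto
    moreover have "(\<lambda>n. f (int j) * avoid_prob n) \<longlonglongrightarrow> f (int j) * 0"
      by (intro tendsto_intros avoid_prob_tendsto_0)
    ultimately have "prob {\<omega> \<in> space M. j \<in> R \<omega> \<and> {j<..} \<inter> R \<omega> = {}} \<le> 0"
      by (intro LIMSEQ_le_const) auto
    then show ?thesis by (simp add: measure_le_0_iff)
  qed
  have zero': "prob {\<omega> \<in> space M. {1..} \<inter> R \<omega> = {}} = 0"
  proof -
    have "prob {\<omega> \<in> space M. {1..} \<inter> R \<omega> = {}} \<le> avoid_prob n" for n
      unfolding avoid_prob_def using measurable_pattern[of "{}" "{1..n}"]
      by (intro finite_measure_mono) auto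
    then have "prob {\<omega> \<in> space M. {1..} \<inter> R \<omega> = {}} \<le> 0"
      using avoid_prob_tendsto_0 by (intro LIMSEQ_le_const) auto
    then show ?thesis by (simp add: measure_le_0_iff)
  qed
  have "AE \<omega> in M. \<not> (j \<in> R \<omega> \<and> {j<..} \<inter> R \<omega> = {})" if "0 < j" for j
    using zero[OF that] measurable_pattern[of "{j}" "{j<..}"]
    by (intro AE_I[where N = "{\<omega> \<in> space M. j \<in> R \<omega> \<and> {j<..} \<inter> R \<omega> = {}}"])
       (auto simp: emeasure_eq_measure)
  then have "AE \<omega> in M. \<forall>j>0. \<not> (j \<in> R \<omega> \<and> {j<..} \<inter> R \<omega> = {})"
    by (simp add: AE_all_countable)
  moreover have "AE \<omega> in M. \<not> ({1..} \<inter> R \<omega> = {})"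
    using zero' measurable_pattern[of "{}" "{1..}"]
    by (intro AE_I[where N = "{\<omega> \<in> space M. {1..} \<inter> R \<omega> = {}}"])
       (auto simp: emeasure_eq_measure)
  ultimately show ?thesis
  proof eventually_elim
    case (elim \<omega>)
    show ?case
    proof
      assume fin: "finite (R \<omega>)"
      define m where "m = Max (R \<omega>)"
      obtain k where k: "1 \<le> k" "k \<in> R \<omega>" using elim(2) by auto
      have "m \<in> R \<omega>" "k \<le> m" unfolding m_def using fin k by (auto intro: Max_in)
      moreover have "{m<..} \<inter> R \<omega> = {}" unfolding m_def using fin by (auto simp: disjoint_iff leD)
      ultimately show False using elim(1) k by auto
    qed
  qed
qed

end

lemma prob_mem: "0 < j \<Longrightarrow> prob {\<omega> \<in> space M. j \<in> R \<omega>} = f (int j)"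
  using law[of "[j]"] by simp

text \<open>The mean of \<open>N (2 ^ k) / 2 ^ k\<close> is summable in \<open>k\<close>, so almost
  surely the series of these densities converges and its terms vanish. Monotonicity of the count
  fills the gaps between powers of 2.\<close>

lemma AE_frequency_0:
  assumes f_le: "\<And>j. 0 < j \<Longrightarrow> f (int j) \<le> C / real j"
  shows "AE \<omega> in M. has_frequency (R \<omega>) 0"
proof -
  define N where "N n \<omega> = real (card (R \<omega> \<inter> {1..n}))" for n \<omega>
  have N_eq: "N n \<omega> = (\<Sum>j=1..n. indicator {\<omega> \<in> space M. j \<in> R \<omega>} \<omega>)" if "\<omega> \<in> space M" for n \<omega>
    using that by (simp add: N_def indicator_def sum.If_cases Int_def conj_commute)
  have "0 \<le> C" using f_le[of 1] law[of "[1]"] measure_nonneg[of M "{\<omega> \<in> space M. 1 \<in> R \<omega>}"] by simp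
  \<comment> \<open>The dyadic block from \<open>2 ^ k + 1\<close> to \<open>2 ^ (k + 1)\<close> has
    \<open>2 ^ k\<close> terms of size at most \<open>1 / 2 ^ k\<close>.\<close>
  have harm: "(\<Sum>j=1..2 ^ k. 1 / real j) \<le> real k + 1" for k :: nat
  proof (induction k)
    case (Suc k)
    have "(\<Sum>j=1..2 ^ Suc k. 1 / real j) = (\<Sum>j=1..2 ^ k. 1 / real j) + (\<Sum>j=2 ^ k + 1..2 ^ k + 2 ^ k. 1 / real j)"
      by (subst sum.ub_add_nat[symmetric]) (simp_all add: mult_2)
    also have "(\<Sum>j=2 ^ k + 1..2 ^ k + 2 ^ k. 1 / real j) \<le> (\<Sum>j=2 ^ k + (1::nat)..2 ^ k + 2 ^ k. 1 / 2 ^ k)"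
      by (intro sum_mono divide_left_mono) (auto simp flip: of_nat_power_le_of_nat_cancel_iff simp: numeral_power_le_of_nat_cancel_iff)
    also have "\<dots> = 1" by simp
    finally show ?case using Suc by simp
  qed simp
  have sum_f: "(\<Sum>j=1..2 ^ k. f (int j)) \<le> C * (real k + 1)" for k :: nat
  proof -
    have "(\<Sum>j=1..2 ^ k. f (int j)) \<le> (\<Sum>j=1..2 ^ k. C * (1 / real j))"
      using f_le by (intro sum_mono) auto
    also have "\<dots> = C * (\<Sum>j=1..2 ^ k. 1 / real j)" by (simp add: sum_distrib_left)
    also have "\<dots> \<le> C * (real k + 1)" using harm \<open>0 \<le> C\<close> by (rule mult_left_mono)
    finally show ?thesis .
  qed
  have N_meas [measurable]: "N n \<in> borel_measurable M" for n
    using measurable_mem by (subst measurable_cong[OF N_eq]) auto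
  have expect: "(\<integral>\<^sup>+\<omega>. ennreal (N (2 ^ k) \<omega> / 2 ^ k) \<partial>M) \<le> ennreal (C * (real k + 1) / 2 ^ k)" for k
  proof -
    have int: "integrable M (\<lambda>\<omega>. N (2 ^ k) \<omega> / 2 ^ k)"
    proof (rule integrable_const_bound[where B = 1])
      have "card (R \<omega> \<inter> {1..2 ^ k}) \<le> 2 ^ k" for \<omega>
        using card_mono[of "{1..2 ^ k}" "R \<omega> \<inter> {1..2 ^ k}"] by simp
      then have "N (2 ^ k) \<omega> \<le> 2 ^ k" for \<omega>
        unfolding N_def by (simp add: numeral_power_le_of_nat_cancel_iff of_nat_le_numeral_power_cancel_iff)
      then show "AE \<omega> in M. norm (N (2 ^ k) \<omega> / 2 ^ k) \<le> 1"
        by (simp add: N_def)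
    qed simp
    have "(\<integral>\<^sup>+\<omega>. ennreal (N (2 ^ k) \<omega> / 2 ^ k) \<partial>M) = ennreal (\<integral>\<omega>. N (2 ^ k) \<omega> / 2 ^ k \<partial>M)"
      using int by (intro nn_integral_eq_integral) (auto simp: N_def)
    also have "(\<integral>\<omega>. N (2 ^ k) \<omega> / 2 ^ k \<partial>M) = (\<integral>\<omega>. (\<Sum>j=1..2 ^ k. indicator {\<omega> \<in> space M. j \<in> R \<omega>} \<omega>) \<partial>M) / 2 ^ k"
      by (simp add: N_eq cong: Bochner_Integration.integral_cong)
    also have "(\<integral>\<omega>. (\<Sum>j=1..2 ^ k. indicator {\<omega> \<in> space M. j \<in> R \<omega>} \<omega>) \<partial>M) = (\<Sum>j=1..2 ^ k. f (int j))"
    proof -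
      have "(\<integral>\<omega>. (\<Sum>j=1..2 ^ k. indicator {\<omega> \<in> space M. j \<in> R \<omega>} \<omega>) \<partial>M)
          = (\<Sum>j=1..2 ^ k. prob {\<omega> \<in> space M. j \<in> R \<omega>} :: real)"
        using measurable_mem
        by (subst Bochner_Integration.integral_sum) (auto simp: emeasure_eq_measure Int_absorb1 intro!: sum.cong integrable_real_indicator)
      also have "\<dots> = (\<Sum>j=1..2 ^ k. f (int j))"
        by (intro sum.cong prob_mem) auto
      finally show ?thesis .
    qed
    finally show ?thesis using sum_f[of k] by (auto intro!: ennreal_leI divide_right_mono)
  qed
  have "summable (\<lambda>k. C * (real k + 1) / 2 ^ k)"
  proof -
    have "summable (\<lambda>k. C * ((real k + 1) * (1 / 2) ^ k))"
      using geometric_deriv_sums[of "1 / 2 :: real"]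
      by (intro summable_mult) (auto simp: sums_iff add.commute)
    then show ?thesis by (simp add: power_divide)
  qed
  then have fin: "(\<Sum>k. ennreal (C * (real k + 1) / 2 ^ k)) \<noteq> \<top>"
    using \<open>0 \<le> C\<close> by (subst suminf_ennreal2) auto
  have "(\<integral>\<^sup>+\<omega>. (\<Sum>k. ennreal (N (2 ^ k) \<omega> / 2 ^ k)) \<partial>M) = (\<Sum>k. \<integral>\<^sup>+\<omega>. ennreal (N (2 ^ k) \<omega> / 2 ^ k) \<partial>M)"
    by (rule nn_integral_suminf) simp
  also have "\<dots> \<le> (\<Sum>k. ennreal (C * (real k + 1) / 2 ^ k))"
    by (intro suminf_le expect) auto
  finally have "(\<integral>\<^sup>+\<omega>. (\<Sum>k. ennreal (N (2 ^ k) \<omega> / 2 ^ k)) \<partial>M) \<noteq> \<infinity>"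
    using fin by (auto simp: top_unique)
  then have "AE \<omega> in M. (\<Sum>k. ennreal (N (2 ^ k) \<omega> / 2 ^ k)) \<noteq> \<infinity>"
    by (intro nn_integral_PInf_AE) auto
  then show ?thesis
  proof eventually_elim
    case (elim \<omega>)
    then have "summable (\<lambda>k. N (2 ^ k) \<omega> / 2 ^ k)"
      by (intro summable_suminf_not_top) (auto simp: N_def)
    then have lim: "(\<lambda>k. N (2 ^ k) \<omega> / 2 ^ k) \<longlonglongrightarrow> 0" by (rule summable_LIMSEQ_zero)
    show ?case unfolding has_frequency_def
    proof (rule LIMSEQ_I)
      fix e :: real assume "0 < e"
      \<comment> \<open>Half of \<open>e\<close> absorbs the factor 2 lost in
        \<open>2 ^ Suc k \<le> 2 * n\<close>.\<close>
      then obtain K where K: "\<And>k. K \<le> k \<Longrightarrow> N (2 ^ k) \<omega> / 2 ^ k < e / 2"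
        using LIMSEQ_D[OF lim, of "e / 2"] by (auto simp: N_def)
      have "1 / real n * real (card (R \<omega> \<inter> {1..n})) < e" if "2 ^ K \<le> n" for n
      proof -
        have "0 < n" using that by (auto intro: gr0I)
        then obtain k where k: "2 ^ k \<le> n" "n < 2 ^ Suc k"
          using ex_power_ivl1[of 2 n] by auto
        have "K \<le> Suc k"
        proof (rule ccontr)
          assume "\<not> K \<le> Suc k"
          then have "(2::nat) ^ Suc k \<le> 2 ^ K" by (intro power_increasing) auto
          then show False using k that by simp
        qed
        have "real (card (R \<omega> \<inter> {1..n})) \<le> N (2 ^ Suc k) \<omega>"
          unfolding N_def using k(2) by (intro of_nat_mono card_mono) auto
        also have "\<dots> < e / 2 * 2 ^ Suc k"
          using K[OF \<open>K \<le> Suc k\<close>] by (simp add: field_simps)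
        also have "\<dots> = e * real (2 ^ k)" by simp
        also have "\<dots> \<le> e * real n" using k(1) \<open>0 < e\<close> by (intro mult_left_mono) (auto simp del: of_nat_power)
        finally show ?thesis using \<open>0 < n\<close> by (simp add: field_simps)
      qed
      then show "\<exists>no. \<forall>n\<ge>no. norm (1 / real n * real (card (R \<omega> \<inter> {1..n})) - 0) < e"
        by (intro exI[of _ "2 ^ K"]) simp
    qed
  qed
qed

end

section \<open>Weighted walks\<close>

text \<open>Paths are lists of steps (\<open>True\<close> = up) with the latest step first.\<close>

fun path_pos :: "bool list \<Rightarrow> int" where
  "path_pos [] = 0"
| "path_pos (s # w) = path_pos w + (if s then 1 else - 1)"

text \<open>Minus the running minimum, so level \<open>- j\<close> has been reached exactly when
  \<open>j \<le> path_depth w\<close>.\<close>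

fun path_depth :: "bool list \<Rightarrow> int" where
  "path_depth [] = 0"
| "path_depth (s # w) = max (path_depth w) (- path_pos (s # w))"

lemma path_depth_ge: "- path_pos w \<le> path_depth w"
  by (cases w) auto

lemma path_depth_True: "path_depth (True # w) = path_depth w"
  using path_depth_ge[of w] by auto

lemma path_depth_mono: "path_depth w \<le> path_depth (s # w)"
  by simp

text \<open>Each step carries the fair-coin factor 1/2 and a penalty \<open>c\<close>, later the
  probability that the tree grafted at this step is admissible.\<close>

fun path_weight :: "(bool \<Rightarrow> bool list \<Rightarrow> real) \<Rightarrow> bool list \<Rightarrow> real" where
  "path_weight c [] = 1"
| "path_weight c (s # w) = path_weight c w * c s w / 2"

lemma sum_paths_Suc:
  "(\<Sum>w | length w = Suc n. F w) = (\<Sum>w | length w = n. F (True # w) + F (False # w))"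
proof -
  have fin: "finite {w :: bool list. length w = n}"
    using finite_lists_length_eq[of "UNIV :: bool set" n] by simp
  have "{w. length w = Suc n} = (#) True ` {w. length w = n} \<union> (#) False ` {w. length w = n}"
    by (auto simp: length_Suc_conv image_iff)
  moreover have "(#) True ` {w. length w = n} \<inter> (#) False ` {w. length w = n} = {}" by auto
  ultimately show ?thesis
    using fin by (simp add: sum.union_disjoint sum.reindex sum.distrib)
qed

text \<open>The hypothesis says that \<open>H\<close> is harmonic for the penalised walk, so the
  weighted sum is a martingale expectation and does not depend on \<open>n\<close>.\<close>

lemma sum_path_weight:
  assumes "\<And>w. length w < N \<Longrightarrow> H w = (c True w * H (True # w) + c False w * H (False # w)) / 2"
  shows "n \<le> N \<Longrightarrow> (\<Sum>w | length w = n. path_weight c w * H w) = H []"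
proof (induction n)
  case (Suc n)
  have "(\<Sum>w | length w = Suc n. path_weight c w * H w) =
      (\<Sum>w | length w = n. path_weight c w * ((c True w * H (True # w) + c False w * H (False # w)) / 2))"
    by (subst sum_paths_Suc) (auto intro!: sum.cong simp: algebra_simps add_divide_distrib)
  also have "\<dots> = (\<Sum>w | length w = n. path_weight c w * H w)"
    using Suc.prems assms by (intro sum.cong) auto
  finally show ?case using Suc by simp
qed simp

text \<open>The probability that a simple symmetric walk from \<open>x\<close> stays positive during
  \<open>n\<close> steps.\<close>

fun survival :: "nat \<Rightarrow> int \<Rightarrow> real" where
  "survival 0 x = (if 1 \<le> x then 1 else 0)"
| "survival (Suc n) x = (if 1 \<le> x then (survival n (x - 1) + survival n (x + 1)) / 2 else 0)"

lemma survival_bounds: "0 \<le> survival n x \<and> survival n x \<le> 1"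
proof (induction n arbitrary: x)
  case (Suc n)
  show ?case using Suc[of "x - 1"] Suc[of "x + 1"] by auto
qed simp

lemma survival_0: "survival n 0 = 0"
  by (cases n) auto

text \<open>The limit is a bounded harmonic function on the half-line that vanishes at 0.\<close>

lemma survival_tendsto_0: "(\<lambda>n. survival n (int m)) \<longlonglongrightarrow> 0"
proof -
  have Suc_le: "survival (Suc n) x \<le> survival n x" for n x
  proof (induction n arbitrary: x)
    case 0
    then show ?case using survival_bounds[of 0] by auto
  next
    case (Suc n)
    show ?case
    proof (cases "1 \<le> x")
      case True
      have "(survival (Suc n) (x - 1) + survival (Suc n) (x + 1)) / 2 \<le> (survival n (x - 1) + survival n (x + 1)) / 2"
        using Suc[of "x - 1"] Suc[of "x + 1"] by (intro divide_right_mono add_mono) auto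
      then show ?thesis
        using True by (simp only: survival.simps(2)[of "Suc n" x] survival.simps(2)[of n x] if_True)
    qed simp
  qed
  have "convergent (\<lambda>n. survival n x)" for x
  proof -
    have "decseq (\<lambda>n. survival n x)" using Suc_le by (rule decseq_SucI)
    moreover have "\<forall>n. 0 \<le> survival n x" by (simp add: survival_bounds)
    ultimately obtain L where "(\<lambda>n. survival n x) \<longlonglongrightarrow> L"
      by (rule decseq_convergent)
    then show ?thesis by (rule convergentI)
  qed
  then obtain v where v: "\<And>x. (\<lambda>n. survival n x) \<longlonglongrightarrow> v x" unfolding convergent_def by metis
  have v_step: "v x = (v (x - 1) + v (x + 1)) / 2" if "1 \<le> x" for x
  proof (rule LIMSEQ_unique)
    show "(\<lambda>n. survival (Suc n) x) \<longlonglongrightarrow> v x" by (rule LIMSEQ_Suc[OF v])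
    show "(\<lambda>n. survival (Suc n) x) \<longlonglongrightarrow> (v (x - 1) + v (x + 1)) / 2"
      using that by (auto intro!: tendsto_intros v)
  qed
  have "v (int m) = 0"
  proof (rule bounded_convex_zero[where d = "\<lambda>n. v (int n)"])
    show "v (int 0) = 0" using v[of 0] by (simp add: survival_0 LIMSEQ_const_iff)
    show "0 \<le> v (int n)" for n by (rule LIMSEQ_le_const[OF v]) (use survival_bounds in auto)
    show "v (int n) \<le> 1" for n by (rule LIMSEQ_le_const2[OF v]) (use survival_bounds in auto)
    show "2 * v (int (Suc n)) \<le> v (int n) + v (int (Suc (Suc n)))" for n
      using v_step[of "int (Suc n)"] by (simp add: add.commute)
  qed
  then show ?thesis using v[of "int m"] by simp
qed

text \<open>\<open>H\<close> is the conditional probability of survival over the remaining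
  \<open>N - length w\<close> steps; the martingale identity applies with unit penalties.\<close>

lemma sum_survival:
  assumes "0 < m"
  shows "(\<Sum>w | length w = N. if path_depth w < m then (1 / 2) ^ N else 0) = survival N m"
proof -
  define H where "H w = (if path_depth w < m then survival (N - length w) (path_pos w + m) else 0)" for w
  have "(\<Sum>w | length w = N. path_weight (\<lambda>_ _. 1) w * H w) = H []"
  proof (rule sum_path_weight[OF _ order_refl])
    fix w :: "bool list" assume len: "length w < N"
    define n where "n = N - Suc (length w)"
    have n: "N - length w = Suc n" "N - Suc (length w) = n" using len by (auto simp: n_def)
    show "H w = (1 * H (True # w) + 1 * H (False # w)) / 2"
    proof (cases "path_depth w < m")
      case True
      have pos: "1 \<le> path_pos w + m" using path_depth_ge[of w] True by simp
      have "H (True # w) = survival n (path_pos w + m + 1)"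
        using True unfolding H_def path_depth_True by (simp add: n algebra_simps)
      moreover have "H (False # w) = survival n (path_pos w + m - 1)"
      \<comment> \<open>At height 1 the down-step reaches level \<open>- m\<close>, where the zero
        of \<open>H\<close> matches \<open>survival n 0 = 0\<close>.\<close>
      proof (cases "path_pos w + m = 1")
        case True
        then have "path_pos w + m - 1 = 0" "\<not> path_depth (False # w) < m" by auto
        then show ?thesis by (simp only: H_def survival_0 if_False)
      next
        case False
        then have "path_depth (False # w) < m" using True pos by auto
        then show ?thesis by (simp add: H_def n algebra_simps)
      qed
      moreover have "H w = survival (Suc n) (path_pos w + m)" using True by (simp add: H_def n)
      ultimately show ?thesis using pos by simp
    next
      case False
      then have "\<not> path_depth (s # w) < m" for s using path_depth_mono[of w s] by linarith
      then show ?thesis using False by (simp add: H_def)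
    qed
  qed
  moreover have "path_weight (\<lambda>_ _. 1) w * H w = (if path_depth w < m then (1 / 2) ^ N else 0)"
    if "length w = N" for w
  proof -
    have "path_weight (\<lambda>_ _. 1) w = (1 / 2) ^ length w" by (induction w) (auto simp: power_divide)
    moreover have "1 \<le> path_pos w + m" if "path_depth w < m" using path_depth_ge[of w] that by simp
    ultimately show ?thesis using that by (auto simp: H_def)
  qed
  ultimately show ?thesis using assms by (simp add: H_def)
qed

text \<open>For increasing \<open>js\<close> the head is the smallest target not yet reached; its
  label \<open>- j\<close> is the highest, hence the most restrictive bound on a tree.\<close>

definition pending :: "nat list \<Rightarrow> bool list \<Rightarrow> nat list" where
  "pending js w = filter (\<lambda>j. path_depth w < int j) js"

text \<open>\<open>side\<close> is \<open>True\<close> for the left and \<open>False\<close> for the right part of the bridge, read away from 0. Trees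
  sit at the upper end of the up-steps of the left walk and of the down-steps of the right walk; each
  has to stay above the largest label \<open>- j\<close> that the walk has not yet reached among the targets \<open>js\<close>.\<close>

definition step_factor :: "bool \<Rightarrow> nat list \<Rightarrow> bool \<Rightarrow> bool list \<Rightarrow> real" where
  "step_factor side js s w =
     (if s = side \<and> pending js w \<noteq> []
      then positive_prob (max (path_pos w) (path_pos (s # w)) + int (hd (pending js w))) else 1)"

definition hit_prob :: "bool \<Rightarrow> int \<Rightarrow> real" where
  "hit_prob side x = (if side then 3 / (real_of_int x + 3) else 1 / (real_of_int x + 1))"

lemma hit_prob_bounds: "0 \<le> x \<Longrightarrow> 0 \<le> hit_prob side x \<and> hit_prob side x \<le> 1"
  by (auto simp: hit_prob_def)

lemma hit_prob_0: "hit_prob side 0 = 1"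
  by (simp add: hit_prob_def)

lemma hit_prob_step:
  assumes "1 \<le> x"
  shows "hit_prob side x = ((if side then positive_prob (x + 1) else 1) * hit_prob side (x + 1)
    + (if side then 1 else positive_prob x) * hit_prob side (x - 1)) / 2"
proof -
  define y where "y = real_of_int x"
  have y: "1 \<le> y" using assms by (simp add: y_def)
  then have nz: "y \<noteq> 0" "y + 1 \<noteq> 0" "y + 2 \<noteq> 0" "y + 3 \<noteq> 0" "y + 4 \<noteq> 0" by auto
  show ?thesis
  proof (cases side)
    case True
    have "3 / (y + 3) = ((y + 1) * (y + 4) / ((y + 2) * (y + 3)) * (3 / (y + 4)) + 3 / (y + 2)) / 2"
      using nz by (simp add: divide_simps)
    then show ?thesis using True by (simp add: hit_prob_def positive_prob_def y_def algebra_simps)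
  next
    case False
    have "1 / (y + 1) = (1 / (y + 2) + y * (y + 3) / ((y + 1) * (y + 2)) * (1 / y)) / 2"
      using nz by (simp add: divide_simps)
    then show ?thesis using False by (simp add: hit_prob_def positive_prob_def y_def algebra_simps)
  qed
qed

text \<open>Intended as the conditional probability, given the path so far, that the trees still to
  come respect all pending targets.\<close>

definition path_value :: "bool \<Rightarrow> nat list \<Rightarrow> bool list \<Rightarrow> real" where
  "path_value side js w = gap_prod (hit_prob side) (- path_pos w) (pending js w)"

text \<open>A step changes only the gap to the first pending target, so the recursion for
  \<open>hit_prob\<close> applies. When a target is reached its factor becomes
  \<open>hit_prob side 0 = 1\<close>, consistent with its removal from the list.\<close>

lemma path_value_harmonic:
  assumes sorted: "sorted_wrt (<) js"
  shows "path_value side js w = (step_factor side js True w * path_value side js (True # w)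
    + step_factor side js False w * path_value side js (False # w)) / 2"
proof (cases "pending js w")
  case Nil
  then have "pending js (s # w) = []" for s
    using path_depth_mono[of w s] by (auto simp: pending_def filter_empty_conv not_less simp del: path_depth.simps)
  then show ?thesis using Nil by (simp add: path_value_def step_factor_def)
next
  case (Cons j js')
  define x where "x = path_pos w + int j"
  have sorted': "sorted_wrt (<) (j # js')"
    using sorted_wrt_filter[OF sorted] Cons unfolding pending_def by metis
  have "j \<in> set (pending js w)" using Cons by simp
  then have "path_depth w < int j" by (simp add: pending_def)
  then have x1: "1 \<le> x" using path_depth_ge[of w] by (simp add: x_def)
  let ?G = "gap_prod (hit_prob side) (int j) js'"
  have now: "path_value side js w = hit_prob side x * ?G"
    using Cons by (simp add: path_value_def x_def add.commute)
  have up: "path_value side js (True # w) = hit_prob side (x + 1) * ?G"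
  proof -
    have "pending js (True # w) = j # js'" using Cons unfolding pending_def path_depth_True .
    then show ?thesis by (simp add: path_value_def x_def algebra_simps)
  qed
  have down: "path_value side js (False # w) = hit_prob side (x - 1) * ?G"
  proof -
    have pend: "pending js (False # w) = filter (\<lambda>i. 1 - path_pos w < int i) (j # js')"
      unfolding Cons[symmetric] by (auto simp: pending_def intro!: filter_cong)
    show ?thesis
    \<comment> \<open>For \<open>x = 1\<close> the down-step reaches exactly the target
      \<open>j\<close> and no further one, since targets increase strictly.\<close>
    proof (cases "x = 1")
      case True
      have "filter (\<lambda>i. 1 - path_pos w < int i) js' = js'"
        using sorted' True by (auto simp: x_def filter_id_conv)
      then have "pending js (False # w) = js'"
        using True unfolding pend by (simp add: x_def)
      moreover have "- path_pos (False # w) = int j" using True by (simp add: x_def)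
      ultimately show ?thesis using True by (simp only: path_value_def) (simp add: hit_prob_0)
    next
      case False
      have "filter (\<lambda>i. 1 - path_pos w < int i) (j # js') = j # js'"
        using sorted' False x1 by (subst filter_id_conv) (auto simp: x_def)
      then show ?thesis
        unfolding pend[symmetric] by (simp add: path_value_def x_def algebra_simps)
    qed
  qed
  have "step_factor side js True w = (if side then positive_prob (x + 1) else 1)"
    "step_factor side js False w = (if side then 1 else positive_prob x)"
    using Cons by (auto simp: step_factor_def x_def algebra_simps max_def)
  then show ?thesis unfolding now up down using hit_prob_step[OF x1, of side]
    by (simp add: algebra_simps add_divide_distrib)
qed

lemma gap_prod_bounds:
  assumes "sorted_wrt (<) js" "\<forall>j\<in>set js. k \<le> int j"
  shows "0 \<le> gap_prod (hit_prob side) k js \<and> gap_prod (hit_prob side) k js \<le> 1"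
  using assms
proof (induction js arbitrary: k)
  case (Cons j js)
  have "0 \<le> gap_prod (hit_prob side) (int j) js \<and> gap_prod (hit_prob side) (int j) js \<le> 1"
    using Cons by (intro Cons.IH) auto
  moreover have "0 \<le> hit_prob side (int j - k) \<and> hit_prob side (int j - k) \<le> 1"
    using Cons.prems by (intro hit_prob_bounds) auto
  ultimately show ?case by (auto intro: mult_le_one)
qed simp

lemma path_value_bounds:
  assumes "sorted_wrt (<) js"
  shows "0 \<le> path_value side js w \<and> path_value side js w \<le> 1"
  unfolding path_value_def pending_def using assms path_depth_ge[of w]
  by (intro gap_prod_bounds sorted_wrt_filter) auto

lemma step_factor_bounds: "0 \<le> step_factor side js s w \<and> step_factor side js s w \<le> 1"
proof (cases "s = side \<and> pending js w \<noteq> []")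
  case True
  then have "hd (pending js w) \<in> set (pending js w)" by simp
  then have "path_depth w < int (hd (pending js w))" by (simp add: pending_def)
  then have "0 \<le> max (path_pos w) (path_pos (s # w)) + int (hd (pending js w))"
    using path_depth_ge[of w] by simp
  from positive_prob_bounds[OF this] show ?thesis using True by (simp add: step_factor_def)
qed (auto simp: step_factor_def)

lemma path_weight_bounds:
  "0 \<le> path_weight (step_factor side js) w \<and> path_weight (step_factor side js) w \<le> (1 / 2) ^ length w"
proof (induction w)
  case (Cons s w)
  have "path_weight (step_factor side js) w * step_factor side js s w \<le> (1 / 2) ^ length w * 1"
    using Cons step_factor_bounds by (intro mult_mono) auto
  then show ?case using Cons step_factor_bounds[of side js s w] by (simp add: power_divide field_simps)
qed simp

text \<open>\<open>path_value\<close> is a martingale under the weights and equals 1 once the last target is reached.\<close>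

lemma sum_path_weight_tendsto:
  assumes "sorted_wrt (<) js" "0 \<notin> set js"
  shows "(\<lambda>N. \<Sum>w | length w = N. path_weight (step_factor side js) w)
    \<longlonglongrightarrow> gap_prod (hit_prob side) 0 js"
proof -
  \<comment> \<open>\<open>m\<close> exceeds every target, so a pending target forces depth below
    \<open>m\<close>; the inserted 0 covers the empty list.\<close>
  define m where "m = Suc (Max (insert 0 (set js)))"
  let ?W = "path_weight (step_factor side js)" and ?H = "path_value side js"
  let ?S = "\<lambda>N. \<Sum>w | length w = N. ?W w"
  have init: "?H [] = gap_prod (hit_prob side) 0 js"
  proof -
    have "pending js [] = js" using assms(2) by (auto simp: pending_def filter_id_conv intro: gr0I)
    then show ?thesis by (simp add: path_value_def)
  qed
  have mart: "(\<Sum>w | length w = N. ?W w * ?H w) = gap_prod (hit_prob side) 0 js" for N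
    unfolding init[symmetric]
    by (rule sum_path_weight[OF _ order_refl]) (rule path_value_harmonic[OF assms(1)])
  \<comment> \<open>The error lives on paths with a pending target, because
    \<open>path_value\<close> is 1 once none is left. Such paths stay above \<open>- m\<close>, an
    event of probability \<open>survival N m\<close>.\<close>
  have weighted: "0 \<le> ?W w * (1 - ?H w) \<and>
      ?W w * (1 - ?H w) \<le> (if path_depth w < int m then (1 / 2) ^ N else 0)" if "length w = N" for w N
  proof (cases "pending js w = []")
    case True
    then show ?thesis by (simp add: path_value_def)
  next
    case False
    then obtain j where "j \<in> set js" "path_depth w < int j"
      by (auto simp: pending_def filter_empty_conv)
    moreover from this have "j \<le> m" unfolding m_def by (simp add: le_SucI)
    ultimately have "path_depth w < int m" by simp
    moreover have "?W w * (1 - ?H w) \<le> (1 / 2) ^ N * 1"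
      using path_weight_bounds[of side js w] path_value_bounds[OF assms(1), of side w] that
      by (intro mult_mono) auto
    ultimately show ?thesis
      using path_weight_bounds[of side js w] path_value_bounds[OF assms(1), of side w] by simp
  qed
  have diff: "?S N - gap_prod (hit_prob side) 0 js = (\<Sum>w | length w = N. ?W w * (1 - ?H w))" for N
    unfolding mart[of N, symmetric] by (simp add: sum_subtractf algebra_simps)
  have "(\<lambda>N. ?S N - gap_prod (hit_prob side) 0 js) \<longlonglongrightarrow> 0"
  proof (rule real_tendsto_sandwich)
    show "\<forall>\<^sub>F N in sequentially. 0 \<le> ?S N - gap_prod (hit_prob side) 0 js"
      unfolding diff using weighted by (intro always_eventually allI sum_nonneg) blast
    show "\<forall>\<^sub>F N in sequentially. ?S N - gap_prod (hit_prob side) 0 js \<le> survival N (int m)"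
    proof (intro always_eventually allI)
      fix N
      have "0 < int m" by (simp add: m_def)
      show "?S N - gap_prod (hit_prob side) 0 js \<le> survival N (int m)"
        unfolding diff sum_survival[OF \<open>0 < int m\<close>, symmetric]
      proof (rule sum_mono)
        fix w :: "bool list" assume "w \<in> {w. length w = N}"
        then show "?W w * (1 - ?H w) \<le> (if path_depth w < int m then (1 / 2) ^ N else 0)"
          using weighted[of w N] by simp
      qed
    qed
  qed (auto simp: survival_tendsto_0)
  then show ?thesis by (simp add: LIM_zero_iff)
qed

section \<open>The treed bridge\<close>

primrec follows :: "(nat \<Rightarrow> int) \<Rightarrow> bool list \<Rightarrow> bool" where
  "follows X [] \<longleftrightarrow> True"
| "follows X (s # w) \<longleftrightarrow> follows X w \<and> X (Suc (length w)) - X (length w) = (if s then 1 else - 1)"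

lemma follows_pos: "X 0 = 0 \<Longrightarrow> follows X w \<Longrightarrow> X (length w) = path_pos w"
  by (induction w) auto

lemma follows_depth:
  "X 0 = 0 \<Longrightarrow> follows X w \<Longrightarrow> (\<forall>t\<le>length w. - j < X t) \<longleftrightarrow> path_depth w < j"
proof (induction w)
  case (Cons s w)
  have "X (Suc (length w)) = path_pos (s # w)" using follows_pos[of X "s # w"] Cons.prems by simp
  then show ?case using Cons by (auto simp: le_Suc_eq)
qed simp

lemma follows_iff: "follows X w \<longleftrightarrow> (\<forall>n<length w. X (Suc n) - X n = (if rev w ! n then 1 else - 1))"
  by (induction w) (auto simp: less_Suc_eq nth_append)

lemma follows_inj: "follows X w \<Longrightarrow> follows X w' \<Longrightarrow> length w = length w' \<Longrightarrow> w = w'"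
proof (induction w arbitrary: w')
  case (Cons s w)
  then obtain s' v where "w' = s' # v" by (cases w') auto
  with Cons show ?case by (auto split: if_splits)
qed simp

lemma follows_ex: "(\<And>n. \<bar>X (Suc n) - X n\<bar> = 1) \<Longrightarrow> \<exists>w. length w = N \<and> follows X w"
proof (induction N)
  case (Suc N)
  then obtain w where w: "length w = N" "follows X w" by auto
  have "follows X ((X (Suc N) - X N = 1) # w)" using w Suc.prems[of N] by auto
  then show ?case using w(1) by (metis length_Cons)
qed simp

text \<open>With the latest step at the head, the first \<open>n\<close> steps form a suffix of the
  list.\<close>

definition prefix_path :: "bool list \<Rightarrow> nat \<Rightarrow> bool list" where
  "prefix_path w n = drop (length w - n) w"

lemma prefix_path_Cons: "n \<le> length w \<Longrightarrow> prefix_path (s # w) n = prefix_path w n"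
  by (simp add: prefix_path_def Suc_diff_le)

lemma prefix_path_length: "prefix_path w (length w) = w"
  by (simp add: prefix_path_def)

text \<open>The times whose trees matter for the targets along \<open>w\<close>. Fixing
  \<open>w\<close> makes these times, the root labels and the constraints deterministic, as
  conditioning on the bridge requires.\<close>

primrec constrained :: "bool \<Rightarrow> nat list \<Rightarrow> bool list \<Rightarrow> nat set" where
  "constrained side js [] = {}"
| "constrained side js (s # w) =
     (if s = side \<and> pending js w \<noteq> [] then insert (length w) (constrained side js w)
      else constrained side js w)"

definition target :: "nat list \<Rightarrow> bool list \<Rightarrow> nat \<Rightarrow> nat" where
  "target js w n = hd (pending js (prefix_path w n))"

definition tree_height :: "bool list \<Rightarrow> nat \<Rightarrow> int" where
  "tree_height w n = max (path_pos (prefix_path w n)) (path_pos (prefix_path w (Suc n)))"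

lemma constrained_less: "n \<in> constrained side js w \<Longrightarrow> n < length w"
  by (induction w) (auto split: if_splits)

lemma finite_constrained: "finite (constrained side js w)"
  by (induction w) auto

lemma constrained_target:
  "n \<in> constrained side js w \<Longrightarrow> - int (target js w n) < tree_height w n"
proof (induction w)
  case (Cons s w)
  show ?case
  proof (cases "n \<in> constrained side js w")
    case True
    then show ?thesis using Cons constrained_less[OF True]
      by (simp add: target_def tree_height_def prefix_path_Cons)
  next
    case False
    then have n: "n = length w" "pending js w \<noteq> []" using Cons.prems by (auto split: if_splits)
    then have "hd (pending js w) \<in> set (pending js w)" by simp
    then have "path_depth w < int (hd (pending js w))" by (simp add: pending_def)
    then show ?thesis using n path_depth_ge[of w]
      by (simp add: target_def tree_height_def prefix_path_Cons prefix_path_length)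
  qed
qed simp

text \<open>Turns the step-by-step weight of the martingale into a product over trees, the form
  supplied by conditional independence.\<close>

lemma path_weight_eq_prod:
  "path_weight (step_factor side js) w = (1 / 2) ^ length w *
     (\<Prod>n\<in>constrained side js w. positive_prob (tree_height w n + int (target js w n)))"
proof (induction w)
  case (Cons s w)
  have old: "(\<Prod>n\<in>constrained side js w. positive_prob (tree_height (s # w) n + int (target js (s # w) n)))
      = (\<Prod>n\<in>constrained side js w. positive_prob (tree_height w n + int (target js w n)))"
    by (intro prod.cong refl) (auto simp: target_def tree_height_def prefix_path_Cons dest!: constrained_less)
  have new: "length w \<notin> constrained side js w" using constrained_less[of "length w"] by blast
  have last: "prefix_path (s # w) (Suc (length w)) = s # w" by (simp add: prefix_path_def)
  have height: "tree_height (s # w) (length w) = max (path_pos w) (path_pos (s # w))"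
    by (simp add: tree_height_def last prefix_path_Cons prefix_path_length del: path_pos.simps)
  have tgt: "target js (s # w) (length w) = hd (pending js w)"
    by (simp add: target_def prefix_path_Cons prefix_path_length)
  show ?case
  proof (cases "s = side \<and> pending js w \<noteq> []")
    case True
    then have "constrained side js (s # w) = insert (length w) (constrained side js w)" by simp
    moreover have "step_factor side js s w =
        positive_prob (max (path_pos w) (path_pos (s # w)) + int (hd (pending js w)))"
      unfolding step_factor_def using True by (simp only: if_True HOL.simp_thms)
    ultimately show ?thesis using new finite_constrained[of side js w]
      by (simp add: Cons.IH old height tgt del: path_pos.simps constrained.simps)
  next
    case False
    then have "constrained side js (s # w) = constrained side js w" "step_factor side js s w = 1"
      by (auto simp: step_factor_def)
    then show ?thesis by (simp add: Cons.IH old del: constrained.simps)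
  qed
qed simp

lemma labels_above_antimono: "i \<le> k \<Longrightarrow> labels_above (- int i) \<subseteq> labels_above (- int k)"
  by (force simp: labels_above_def)

text \<open>A tree met at time \<open>n\<close> must respect every target pending then. The sets
  \<open>labels_above (- int j)\<close> grow with \<open>j\<close>, so the first pending target
  implies the rest.\<close>

lemma constraints_iff:
  assumes "X 0 = 0" "follows X w" "sorted_wrt (<) js"
    and D: "\<And>n. n \<in> D \<longleftrightarrow> X (Suc n) - X n = (if side then 1 else - 1)"
  shows "(\<forall>n<length w. \<forall>j\<in>set js. n \<in> D \<and> (\<forall>t\<le>n. - int j < X t) \<longrightarrow> \<tau> n \<in> labels_above (- int j))
    \<longleftrightarrow> (\<forall>n\<in>constrained side js w. \<tau> n \<in> labels_above (- int (target js w n)))"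
  using assms(2)
proof (induction w)
  case (Cons s w)
  then have fw: "follows X w" and step: "X (Suc (length w)) - X (length w) = (if s then 1 else - 1)"
    by auto
  have "length w \<in> D \<longleftrightarrow> s = side" using D[of "length w"] step by auto
  moreover have "(\<forall>j\<in>set js. (\<forall>t\<le>length w. - int j < X t) \<longrightarrow> \<tau> (length w) \<in> labels_above (- int j))
      \<longleftrightarrow> (\<forall>j\<in>set (pending js w). \<tau> (length w) \<in> labels_above (- int j))"
    by (auto simp: pending_def follows_depth[OF assms(1) fw])
  moreover have "(\<forall>j\<in>set (pending js w). \<tau> (length w) \<in> labels_above (- int j))
      \<longleftrightarrow> (pending js w \<noteq> [] \<longrightarrow> \<tau> (length w) \<in> labels_above (- int (hd (pending js w))))"
  proof (cases "pending js w")
    case (Cons j js')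
    have "sorted_wrt (<) (j # js')"
      using sorted_wrt_filter[OF assms(3)] Cons unfolding pending_def by metis
    then have "\<forall>k\<in>set js'. labels_above (- int j) \<subseteq> labels_above (- int k)"
      by (intro ballI labels_above_antimono) auto
    then show ?thesis unfolding Cons list.sel list.set by blast
  qed simp
  ultimately have new: "(\<forall>j\<in>set js. length w \<in> D \<and> (\<forall>t\<le>length w. - int j < X t) \<longrightarrow> \<tau> (length w) \<in> labels_above (- int j))
      \<longleftrightarrow> (s = side \<and> pending js w \<noteq> [] \<longrightarrow> \<tau> (length w) \<in> labels_above (- int (target js (s # w) (length w))))"
    by (auto simp: target_def prefix_path_Cons prefix_path_length)
  have old: "(\<forall>n\<in>constrained side js w. \<tau> n \<in> labels_above (- int (target js (s # w) n)))
      \<longleftrightarrow> (\<forall>n\<in>constrained side js w. \<tau> n \<in> labels_above (- int (target js w n)))"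
    using constrained_less by (intro ball_cong refl) (fastforce simp: target_def prefix_path_Cons)
  have "(\<forall>n<length (s # w). \<forall>j\<in>set js. n \<in> D \<and> (\<forall>t\<le>n. - int j < X t) \<longrightarrow> \<tau> n \<in> labels_above (- int j))
     \<longleftrightarrow> (\<forall>n<length w. \<forall>j\<in>set js. n \<in> D \<and> (\<forall>t\<le>n. - int j < X t) \<longrightarrow> \<tau> n \<in> labels_above (- int j))
       \<and> (\<forall>j\<in>set js. length w \<in> D \<and> (\<forall>t\<le>length w. - int j < X t) \<longrightarrow> \<tau> (length w) \<in> labels_above (- int j))"
    by (auto simp: less_Suc_eq)
  also have "\<dots> \<longleftrightarrow> (\<forall>n\<in>constrained side js (s # w). \<tau> n \<in> labels_above (- int (target js (s # w) n)))"
    unfolding Cons.IH[OF fw] new using old by auto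
  finally show ?case .
qed simp

section \<open>The two halves of the bridge, read away from 0\<close>

definition side_index :: "bool \<Rightarrow> nat \<Rightarrow> int" where
  "side_index side n = (if side then - int n else int n)"

definition tree_index :: "bool \<Rightarrow> nat \<Rightarrow> int" where
  "tree_index side n = (if side then - int n - 1 else int n)"

lemma side_index_eq: "side_index side n = tree_index side n + (if side then 1 else 0)"
  by (simp add: side_index_def tree_index_def)

lemma side_index_Suc: "side_index side (Suc n) = tree_index side n + (if side then 0 else 1)"
  by (simp add: side_index_def tree_index_def)

text \<open>Reading the left half away from 0 reverses its steps, so a down-step of the bridge is an
  up-step of the walk there.\<close>

lemma tree_index_down_step:
  "tree_index side n \<in> down_steps b \<longleftrightarrow>
     b (side_index side (Suc n)) - b (side_index side n) = (if side then 1 else - 1)"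
  unfolding side_index_eq[of side n] side_index_Suc[of side n] down_steps_def by (cases side) auto

lemma label_tree_index:
  assumes "tree_index side n \<in> down_steps b"
  shows "b (tree_index side n) = max (b (side_index side n)) (b (side_index side (Suc n)))"
  using assms unfolding side_index_eq[of side n] side_index_Suc[of side n] down_steps_def
  by (cases side) auto

lemma constrained_down_step:
  assumes "b 0 = 0" "follows (\<lambda>n. b (side_index side n)) w" "n \<in> constrained side js w"
  shows "tree_index side n \<in> down_steps b \<and> b (tree_index side n) = tree_height w n"
  using assms(2,3)
proof (induction w)
  case (Cons s w)
  let ?X = "\<lambda>n. b (side_index side n)"
  show ?case
  proof (cases "n \<in> constrained side js w")
    case True
    then show ?thesis using Cons constrained_less[OF True]
      by (simp add: tree_height_def prefix_path_Cons)
  next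
    case False
    then have n: "n = length w" "s = side" using Cons.prems by (auto split: if_splits)
    have X0: "?X 0 = 0" using assms(1) by (simp add: side_index_def)
    have down: "tree_index side n \<in> down_steps b"
      unfolding tree_index_down_step using Cons.prems n by simp
    moreover have "?X (length w) = path_pos w" "?X (Suc (length w)) = path_pos (s # w)"
      using follows_pos[of ?X w] follows_pos[of ?X "s # w"] Cons.prems X0 by auto
    moreover have "prefix_path (s # w) (Suc (length w)) = s # w" by (simp add: prefix_path_def)
    ultimately show ?thesis using label_tree_index[OF down] n
      by (simp add: tree_height_def prefix_path_Cons prefix_path_length)
  qed
qed simp

context treed_bridge
begin

definition bridge_algebra :: "'a measure" where
  "bridge_algebra = vimage_algebra (space M) (\<lambda>\<omega> i. b i \<omega>) (\<Pi>\<^sub>M i\<in>UNIV. count_space UNIV)"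

lemma srw_side: "simple_random_walk (\<lambda>n. b (side_index side n))"
  using walk_right walk_left by (cases side) (simp_all add: side_index_def)

lemma b_measurable [measurable]: "b i \<in> measurable M (count_space UNIV)"
proof (cases "0 \<le> i")
  case True
  then show ?thesis using walk_right[unfolded simple_random_walk_def] by (metis nonneg_int_cases)
next
  case False
  then obtain n where "i = - int n" by (metis nonpos_int_cases linear)
  then show ?thesis using walk_left[unfolded simple_random_walk_def] by blast
qed

declare tree_measurable [measurable]

lemma tree_pred [measurable]: "Measurable.pred M (\<lambda>\<omega>. T i \<omega> \<in> X)"
  by (rule measurable_compose[OF tree_measurable]) simp

lemma b_0: "\<omega> \<in> space M \<Longrightarrow> b 0 \<omega> = 0"
  using walk_right by (simp add: simple_random_walk_def)

lemma bridge_measurable: "(\<lambda>\<omega> i. b i \<omega>) \<in> measurable M (\<Pi>\<^sub>M i\<in>UNIV. count_space UNIV)"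
  by (rule measurable_PiM_single') auto

lemma finite_measure_subalgebra_bridge: "finite_measure_subalgebra M bridge_algebra"
proof
  show "subalgebra M bridge_algebra"
    unfolding subalgebra_def bridge_algebra_def
    using sets_image_in_sets[OF refl bridge_measurable] by simp
qed

lemma bridge_algebra_event:
  assumes "Measurable.pred (\<Pi>\<^sub>M i\<in>UNIV. count_space UNIV) P"
  shows "{\<omega> \<in> space M. P (\<lambda>i. b i \<omega>)} \<in> sets bridge_algebra"
proof -
  have "{f \<in> space (\<Pi>\<^sub>M i\<in>(UNIV :: int set). count_space (UNIV :: int set)). P f} \<in> sets (\<Pi>\<^sub>M i\<in>UNIV. count_space UNIV)"
    using assms by (simp add: pred_def)
  from in_vimage_algebra[OF this, of "\<lambda>\<omega> i. b i \<omega>" "space M"]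
  have "(\<lambda>\<omega> i. b i \<omega>) -` {f \<in> space (\<Pi>\<^sub>M i\<in>(UNIV :: int set). count_space (UNIV :: int set)). P f} \<inter> space M
      \<in> sets bridge_algebra"
    unfolding bridge_algebra_def .
  also have "(\<lambda>\<omega> i. b i \<omega>) -` {f \<in> space (\<Pi>\<^sub>M i\<in>(UNIV :: int set). count_space (UNIV :: int set)). P f} \<inter> space M
      = {\<omega> \<in> space M. P (\<lambda>i. b i \<omega>)}"
    by (auto simp: space_PiM)
  finally show ?thesis .
qed

text \<open>On \<open>W\<close> the bridge fixes the positions and root labels of the trees, so the
  conditional probability is constant there and integrates to a product.\<close>

lemma prob_trees_given_bridge:
  assumes "finite K" "inj_on i K" and W: "W \<in> sets bridge_algebra"
    and down: "\<And>\<omega> k. \<omega> \<in> W \<Longrightarrow> k \<in> K \<Longrightarrow> i k \<in> down_steps (\<lambda>i. b i \<omega>) \<and> b (i k) \<omega> = l k"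
  shows "prob (W \<inter> {\<omega> \<in> space M. \<forall>k\<in>K. T (i k) \<omega> \<in> B k}) = prob W * (\<Prod>k\<in>K. measure (rho (l k)) (B k))"
proof -
  interpret F: finite_measure_subalgebra M bridge_algebra by (rule finite_measure_subalgebra_bridge)
  \<comment> \<open>The conditional law is indexed by positions; injectivity of \<open>i\<close>
    lets \<open>A\<close> carry the constraint \<open>B k\<close> to position
    \<open>i k\<close>.\<close>
  define A where "A x = (\<Inter>k\<in>{k \<in> K. i k = x}. B k)" for x
  have A: "A (i k) = B k" if "k \<in> K" for k
    using that assms(2) by (auto simp: A_def inj_on_def)
  define S where "S = {\<omega> \<in> space M. \<forall>j\<in>i ` K. T j \<omega> \<in> A j}"
  have S_eq: "S = {\<omega> \<in> space M. \<forall>k\<in>K. T (i k) \<omega> \<in> B k}" using A by (auto simp: S_def)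
  have S_meas [measurable]: "S \<in> events" unfolding S_def using assms(1) by measurable
  have W_meas [measurable]: "W \<in> events"
    using W F.subalg by (auto simp: subalgebra_def)
  let ?c = "\<Prod>k\<in>K. measure (rho (l k)) (B k)"
  have "AE \<omega> in M. i ` K \<subseteq> down_steps (\<lambda>i. b i \<omega>) \<longrightarrow>
      real_cond_exp M bridge_algebra (indicator S) \<omega> = (\<Prod>j\<in>i ` K. measure (rho (b j \<omega>)) (A j))"
    unfolding bridge_algebra_def S_def using assms(1) by (intro trees_cond_indep) simp
  then have cond: "AE \<omega> in M. \<omega> \<in> W \<longrightarrow> real_cond_exp M bridge_algebra (indicator S) \<omega> = ?c"
  proof eventually_elim
    case (elim \<omega>)
    show ?case
    proof
      assume \<omega>: "\<omega> \<in> W"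
      then have "real_cond_exp M bridge_algebra (indicator S) \<omega> = (\<Prod>j\<in>i ` K. measure (rho (b j \<omega>)) (A j))"
        using elim down by blast
      also have "\<dots> = ?c"
        using assms(2) A down[OF \<omega>] by (subst prod.reindex) auto
      finally show "real_cond_exp M bridge_algebra (indicator S) \<omega> = ?c" .
    qed
  qed
  have "prob (W \<inter> S) = (\<integral>\<omega>\<in>W. indicator S \<omega> \<partial>M)"
    by (simp add: set_lebesgue_integral_def indicator_inter_arith[symmetric] Int_absorb2 sets.sets_into_space)
  also have "\<dots> = (\<integral>\<omega>\<in>W. real_cond_exp M bridge_algebra (indicator S) \<omega> \<partial>M)"
    by (rule F.real_cond_exp_intA[OF _ W]) (simp add: emeasure_eq_measure)
  also have "\<dots> = (\<integral>\<omega>\<in>W. ?c \<partial>M)"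
    using cond by (intro set_lebesgue_integral_cong_AE) auto
  also have "\<dots> = prob W * ?c"
    by (subst set_integral_const) (auto simp: emeasure_eq_measure)
  finally show ?thesis unfolding S_eq .
qed

lemma prob_follows:
  "prob {\<omega> \<in> space M. follows (\<lambda>n. b (side_index side n) \<omega>) w} = (1 / 2) ^ length w"
proof (cases "length w = 0")
  case True
  then show ?thesis by (simp add: prob_space)
next
  case False
  let ?D = "\<lambda>n \<omega>. b (side_index side (Suc n)) \<omega> - b (side_index side n) \<omega>"
  let ?A = "\<lambda>n. {if rev w ! n then 1 else - 1 :: int}"
  have srw: "indep_vars (\<lambda>_. count_space UNIV) ?D UNIV"
    "\<And>n. distr M (count_space UNIV) (?D n) = measure_pmf (pmf_of_set {-1, 1})"
    using srw_side[of side] by (auto simp: simple_random_walk_def)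
  have "{\<omega> \<in> space M. follows (\<lambda>n. b (side_index side n) \<omega>) w} = (\<Inter>n\<in>{..<length w}. ?D n -` ?A n \<inter> space M)"
    using False by (auto simp: follows_iff)
  also have "prob \<dots> = (\<Prod>n<length w. prob (?D n -` ?A n \<inter> space M))"
    using False by (intro indep_varsD[OF srw(1)]) auto
  also have "\<dots> = (\<Prod>n<length w. 1 / 2)"
  proof (rule prod.cong)
    fix n
    have "prob (?D n -` ?A n \<inter> space M) = measure (distr M (count_space UNIV) (?D n)) (?A n)"
      by (rule measure_distr[symmetric]) auto
    also have "\<dots> = 1 / 2" unfolding srw(2) by (simp add: measure_pmf_single)
    finally show "prob (?D n -` ?A n \<inter> space M) = 1 / 2" .
  qed simp
  finally show ?thesis by (simp add: power_divide)
qed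

lemma AE_steps: "AE \<omega> in M. \<forall>n. \<bar>b (side_index side (Suc n)) \<omega> - b (side_index side n) \<omega>\<bar> = 1"
  unfolding AE_all_countable
proof
  fix n
  let ?D = "\<lambda>\<omega>. b (side_index side (Suc n)) \<omega> - b (side_index side n) \<omega>"
  have "AE x in distr M (count_space UNIV) ?D. \<bar>x\<bar> = 1"
  proof -
    have "distr M (count_space UNIV) ?D = measure_pmf (pmf_of_set {-1, 1})"
      using srw_side[of side] by (simp add: simple_random_walk_def)
    then show ?thesis by (simp only:) (simp add: AE_measure_pmf_iff)
  qed
  then show "AE \<omega> in M. \<bar>?D \<omega>\<bar> = 1"
    by (subst (asm) AE_distr_iff) auto
qed

lemma follows_event: "{\<omega> \<in> space M. follows (\<lambda>n. b (side_index side n) \<omega>) w} \<in> sets bridge_algebra"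
  using bridge_algebra_event[of "\<lambda>f. follows (\<lambda>n. f (side_index side n)) w"]
  unfolding follows_iff by measurable

lemma follows_measurable [measurable]: "Measurable.pred M (\<lambda>\<omega>. follows (\<lambda>n. b (side_index side n) \<omega>) w)"
  unfolding follows_iff by measurable

text \<open>Up to a null set exactly one path of length \<open>N\<close> is followed, so finite sums
  replace conditioning on the infinite bridge.\<close>

lemma prob_eq_sum_paths:
  assumes [measurable]: "E \<in> events"
  shows "prob E = (\<Sum>w | length w = N. prob ({\<omega> \<in> space M. follows (\<lambda>n. b (side_index side n) \<omega>) w} \<inter> E))"
proof -
  let ?F = "\<lambda>w. {\<omega> \<in> space M. follows (\<lambda>n. b (side_index side n) \<omega>) w} \<inter> E"
  have fin: "finite {w :: bool list. length w = N}"
    using finite_lists_length_eq[of "UNIV :: bool set" N] by simp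
  have "prob E = prob (\<Union>w\<in>{w. length w = N}. ?F w)"
  proof (rule finite_measure_eq_AE)
    show "AE \<omega> in M. \<omega> \<in> E \<longleftrightarrow> \<omega> \<in> (\<Union>w\<in>{w. length w = N}. ?F w)"
      using AE_steps[of side] AE_space
    proof eventually_elim
      case (elim \<omega>)
      then show ?case using follows_ex[of "\<lambda>n. b (side_index side n) \<omega>" N] by auto
    qed
    show "(\<Union>w\<in>{w. length w = N}. ?F w) \<in> events" using fin by measurable
  qed simp
  also have "\<dots> = (\<Sum>w | length w = N. prob (?F w))"
  proof (rule finite_measure_finite_Union[OF fin])
    show "?F ` {w. length w = N} \<subseteq> events" by (auto intro!: sets.Int)
    show "disjoint_family_on ?F {w. length w = N}"
      unfolding disjoint_family_on_def using follows_inj by blast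
  qed
  finally show ?thesis .
qed

end

section \<open>Measurability of the geodesic and of the contact events\<close>

instance corner :: countable
  by countable_datatype

text \<open>At most one element is least and the type is countable, so the definite description is
  measurable, including its default value where no least element exists.\<close>

lemma measurable_Least_countable:
  fixes P :: "'c :: {countable, order} \<Rightarrow> 'b \<Rightarrow> bool"
  assumes [measurable]: "\<And>c. Measurable.pred N (P c)"
  shows "(\<lambda>x. LEAST c. P c x) \<in> measurable N (count_space UNIV)"
  unfolding Least_def
  by (rule measurable_THE[where I = UNIV]) (auto intro: antisym)

lemma pred_eq_countable:
  fixes f g :: "'b \<Rightarrow> 'c :: countable"
  assumes [measurable]: "f \<in> measurable N (count_space UNIV)" "g \<in> measurable N (count_space UNIV)"
  shows "Measurable.pred N (\<lambda>x. f x = g x)"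
proof -
  have "Measurable.pred N (\<lambda>x. \<exists>v. f x = v \<and> g x = v)" by measurable
  then show ?thesis by simp
qed

definition contact_times :: "bool \<Rightarrow> (int \<Rightarrow> int) \<Rightarrow> (int \<Rightarrow> ltree) \<Rightarrow> nat set" where
  "contact_times side b T = (if side then R_minus b T else R_plus b T)"

lemma (in regular_bridge) contact_times_iff:
  assumes "0 < j"
  shows "j \<in> contact_times side b T \<longleftrightarrow>
    (\<forall>n. tree_index side n \<in> down_steps b \<and> (\<forall>t\<le>n. - int j < b (side_index side t)) \<longrightarrow>
      T (tree_index side n) \<in> labels_above (- int j))"
  using R_plus_iff[OF assms] R_minus_iff[OF assms]
  by (cases side) (simp_all add: contact_times_def tree_index_def side_index_def)

context treed_bridge
begin

lemma tree_function_measurable [measurable]: "(\<lambda>\<omega>. g (T i \<omega>)) \<in> measurable M (count_space UNIV)"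
  by (rule measurable_compose[OF tree_measurable]) simp

lemma pred_down_step [measurable]: "Measurable.pred M (\<lambda>\<omega>. i \<in> down_steps (\<lambda>i. b i \<omega>))"
  unfolding down_steps_def mem_Collect_eq by measurable

lemma pred_real_corner [measurable]:
  "Measurable.pred M (\<lambda>\<omega>. c \<in> real_corners (\<lambda>i. b i \<omega>) (\<lambda>i. T i \<omega>))"
proof -
  have "c \<in> real_corners (\<lambda>i. b i \<omega>) (\<lambda>i. T i \<omega>) \<longleftrightarrow>
      base c \<in> down_steps (\<lambda>i. b i \<omega>) \<and> T (base c) \<omega> \<in> {t. step c < length (contour t)}" for \<omega>
    by (cases c) (auto simp: real_corners_def)
  then show ?thesis by simp
qed

lemma corner_label_measurable [measurable]:
  "(\<lambda>\<omega>. corner_label (\<lambda>i. T i \<omega>) c) \<in> measurable M (count_space UNIV)"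
  unfolding corner_label_def vertex_label_def corner_vertex_def fst_conv snd_conv
  by (rule tree_function_measurable)

lemma corner_vertex_measurable [measurable]:
  "(\<lambda>\<omega>. corner_vertex (\<lambda>i. T i \<omega>) c) \<in> measurable M (count_space UNIV)"
  unfolding corner_vertex_def by (rule tree_function_measurable)

lemma random_corner_vertex_measurable:
  assumes "C \<in> measurable M (count_space UNIV)"
  shows "(\<lambda>\<omega>. corner_vertex (\<lambda>i. T i \<omega>) (C \<omega>)) \<in> measurable M (count_space UNIV)"
  by (rule measurable_compose_countable[OF corner_vertex_measurable assms])

lemma root_corner_measurable:
  "(\<lambda>\<omega>. root_corner (\<lambda>i. b i \<omega>) (\<lambda>i. T i \<omega>)) \<in> measurable M (count_space UNIV)"
  unfolding root_corner_def by (rule measurable_Least_countable) measurable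

lemma succ_corner_measurable:
  "(\<lambda>\<omega>. succ_corner (\<lambda>i. b i \<omega>) (\<lambda>i. T i \<omega>) c) \<in> measurable M (count_space UNIV)"
proof -
  have [measurable]: "Measurable.pred M (\<lambda>\<omega>. corner_label (\<lambda>i. T i \<omega>) c' = corner_label (\<lambda>i. T i \<omega>) c - 1)" for c'
    by (rule pred_eq_countable) measurable
  show ?thesis unfolding succ_corner_def by (rule measurable_Least_countable) measurable
qed

lemma boundary_vertex_measurable:
  "(\<lambda>\<omega>. boundary_vertex (\<lambda>i. b i \<omega>) (\<lambda>i. T i \<omega>) i) \<in> measurable M (count_space UNIV)"
proof -
  have [measurable]: "Measurable.pred M (\<lambda>\<omega>. corner_label (\<lambda>i. T i \<omega>) c = b i \<omega>)" for c
    by (rule pred_eq_countable) measurable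
  have "(\<lambda>\<omega>. LEAST c. c \<in> real_corners (\<lambda>i. b i \<omega>) (\<lambda>i. T i \<omega>) \<and> i < base c \<and>
      corner_label (\<lambda>i. T i \<omega>) c = b i \<omega>) \<in> measurable M (count_space UNIV)"
    by (rule measurable_Least_countable) measurable
  note [measurable] = random_corner_vertex_measurable[OF this]
  show ?thesis unfolding boundary_vertex_def by measurable
qed

lemma max_geodesic_measurable:
  "(\<lambda>\<omega>. max_geodesic (\<lambda>i. b i \<omega>) (\<lambda>i. T i \<omega>) j) \<in> measurable M (count_space UNIV)"
proof -
  have "(\<lambda>\<omega>. (succ_corner (\<lambda>i. b i \<omega>) (\<lambda>i. T i \<omega>) ^^ j) (root_corner (\<lambda>i. b i \<omega>) (\<lambda>i. T i \<omega>)))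
      \<in> measurable M (count_space UNIV)"
  proof (induction j)
    case (Suc j)
    show ?case
      unfolding funpow.simps comp_def
      by (rule measurable_compose_countable[OF succ_corner_measurable Suc])
  qed (simp add: root_corner_measurable)
  note [measurable] = random_corner_vertex_measurable[OF this] boundary_vertex_measurable
  show ?thesis unfolding max_geodesic_def by measurable
qed

text \<open>The characterisation by trees holds almost surely and \<open>M\<close> need not be
  complete, so measurability comes from the definition: a countable union over boundary
  indices.\<close>

lemma contact_times_event:
  "{\<omega> \<in> space M. j \<in> contact_times side (\<lambda>i. b i \<omega>) (\<lambda>i. T i \<omega>)} \<in> events"
proof -
  have [measurable]: "Measurable.pred M (\<lambda>\<omega>. max_geodesic (\<lambda>i. b i \<omega>) (\<lambda>i. T i \<omega>) j =
      boundary_vertex (\<lambda>i. b i \<omega>) (\<lambda>i. T i \<omega>) i)" for i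
    by (rule pred_eq_countable[OF max_geodesic_measurable boundary_vertex_measurable])
  have "j \<in> contact_times side (\<lambda>i. b i \<omega>) (\<lambda>i. T i \<omega>) \<longleftrightarrow>
      (\<exists>i. (if side then i \<le> 0 else 0 \<le> i) \<and>
        max_geodesic (\<lambda>i. b i \<omega>) (\<lambda>i. T i \<omega>) j = boundary_vertex (\<lambda>i. b i \<omega>) (\<lambda>i. T i \<omega>) i)" for \<omega>
    by (auto simp: contact_times_def R_minus_def R_plus_def left_boundary_def right_boundary_def)
  then show ?thesis by simp
qed

text \<open>On the event that \<open>i\<close> is a down-step of label \<open>l\<close>, the tree
  has conditional law \<open>rho l\<close>, which is carried by well-labeled trees with root label
  \<open>l\<close>; the pairs \<open>(i, l)\<close> are countable.\<close>

lemma AE_trees: "AE \<omega> in M. \<forall>i. i \<in> down_steps (\<lambda>i. b i \<omega>) \<longrightarrow> well_labeled (T i \<omega>) \<and> root_label (T i \<omega>) = b i \<omega>"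
proof -
  have "AE \<omega> in M. \<not> (i \<in> down_steps (\<lambda>i. b i \<omega>) \<and> b i \<omega> = l \<and> T i \<omega> \<notin> {t. well_labeled t \<and> root_label t = l})"
    for i l
  proof -
    let ?B = "{t. well_labeled t \<and> root_label t = l}"
    define W where "W = {\<omega> \<in> space M. i \<in> down_steps (\<lambda>i. b i \<omega>) \<and> b i \<omega> = l}"
    define S where "S = {\<omega> \<in> space M. \<forall>k\<in>{i}. T k \<omega> \<in> ?B}"
    have W: "W \<in> sets bridge_algebra"
    proof -
      have "Measurable.pred (\<Pi>\<^sub>M i\<in>(UNIV :: int set). count_space (UNIV :: int set))
          (\<lambda>f. f (i + 1) - f i = - 1 \<and> f i = l)"
        by measurable
      then have "Measurable.pred (\<Pi>\<^sub>M i\<in>(UNIV :: int set). count_space (UNIV :: int set))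
          (\<lambda>f. i \<in> down_steps f \<and> f i = l)"
        by (rule back_subst[of "Measurable.pred _"]) (auto simp: down_steps_def fun_eq_iff)
      then show ?thesis unfolding W_def by (rule bridge_algebra_event)
    qed
    have [measurable]: "W \<in> events" unfolding W_def by measurable
    have [measurable]: "S \<in> events" unfolding S_def by measurable
    have "prob (W \<inter> S) = prob W * (\<Prod>k\<in>{i}. measure (rho l) ?B)"
      unfolding S_def by (rule prob_trees_given_bridge[where l = "\<lambda>_. l", OF _ _ W]) (auto simp: W_def)
    then have "prob (W \<inter> S) = prob W" by (simp add: rho_well_labeled)
    then have "prob (W - S) = 0" by (simp add: finite_measure_Diff')
    then show ?thesis
      by (intro AE_I[where N = "W - S"]) (auto simp: W_def S_def emeasure_eq_measure)
  qed
  then have "AE \<omega> in M. \<forall>i l. \<not> (i \<in> down_steps (\<lambda>i. b i \<omega>) \<and> b i \<omega> = l \<and> T i \<omega> \<notin> {t. well_labeled t \<and> root_label t = l})"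
    by (simp only: AE_all_countable) blast
  then show ?thesis by eventually_elim auto
qed

text \<open>Staying above \<open>- m\<close> for \<open>N\<close> steps has probability
  \<open>survival N m\<close>, which tends to 0. A level passed by steps of size 1 is hit
  exactly.\<close>

lemma AE_hits: "AE \<omega> in M. \<forall>m. \<exists>n. b (side_index side n) \<omega> = - int m"
proof -
  have low: "AE \<omega> in M. \<exists>n. b (side_index side n) \<omega> \<le> - int m" if "0 < m" for m
  proof -
    let ?E = "\<lambda>N. {\<omega> \<in> space M. \<forall>t\<le>N. - int m < b (side_index side t) \<omega>}"
    have E_meas [measurable]: "?E N \<in> events" for N by measurable
    have E_prob: "prob (?E N) = survival N (int m)" for N
    proof -
      have "prob (?E N) = (\<Sum>w | length w = N. prob ({\<omega> \<in> space M. follows (\<lambda>n. b (side_index side n) \<omega>) w} \<inter> ?E N))"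
        by (rule prob_eq_sum_paths) measurable
      also have "\<dots> = (\<Sum>w | length w = N. if path_depth w < int m then (1 / 2) ^ N else 0)"
      proof (rule sum.cong)
        fix w :: "bool list" assume "w \<in> {w. length w = N}"
        then have len: "length w = N" by simp
        have "(\<forall>t\<le>N. - int m < b (side_index side t) \<omega>) \<longleftrightarrow> path_depth w < int m"
          if "\<omega> \<in> space M" "follows (\<lambda>n. b (side_index side n) \<omega>) w" for \<omega>
          using follows_depth[of "\<lambda>n. b (side_index side n) \<omega>" w "int m"] that b_0
          by (simp add: len side_index_def)
        then have "{\<omega> \<in> space M. follows (\<lambda>n. b (side_index side n) \<omega>) w} \<inter> ?E N =
            (if path_depth w < int m then {\<omega> \<in> space M. follows (\<lambda>n. b (side_index side n) \<omega>) w} else {})"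
          by auto
        then show "prob ({\<omega> \<in> space M. follows (\<lambda>n. b (side_index side n) \<omega>) w} \<inter> ?E N) =
            (if path_depth w < int m then (1 / 2) ^ N else 0)"
          by (simp add: prob_follows len)
      qed simp
      also have "\<dots> = survival N (int m)" using that by (intro sum_survival) simp
      finally show ?thesis .
    qed
    let ?I = "{\<omega> \<in> space M. \<forall>t. - int m < b (side_index side t) \<omega>}"
    have "prob ?I \<le> survival N (int m)" for N
      unfolding E_prob[symmetric] by (intro finite_measure_mono) auto
    then have "prob ?I \<le> 0"
      using survival_tendsto_0[of m] by (intro LIMSEQ_le_const) auto
    then have "prob ?I = 0" by (simp add: measure_le_0_iff)
    then show ?thesis
      by (intro AE_I[where N = ?I]) (auto simp: emeasure_eq_measure not_le)
  qed
  have "AE \<omega> in M. \<forall>m. 0 < m \<longrightarrow> (\<exists>n. b (side_index side n) \<omega> \<le> - int m)"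
    using low by (auto simp: AE_all_countable)
  with AE_steps[of side] AE_space show ?thesis
  proof eventually_elim
    case (elim \<omega>)
    show ?case
    proof
      fix m
      have start: "b (side_index side 0) \<omega> = 0" using elim(2) b_0 by (simp add: side_index_def)
      show "\<exists>n. b (side_index side n) \<omega> = - int m"
      proof (cases "m = 0")
        case True
        then show ?thesis using start by auto
      next
        case False
        then obtain n where n: "b (side_index side n) \<omega> \<le> - int m" using elim(3) by auto
        have "b (side_index side k) \<omega> \<le> b (side_index side (Suc k)) \<omega> + 1" for k
          using elim(1)[rule_format, of k] by arith
        then obtain k where "b (side_index side k) \<omega> = - int m"
          using skip_free_hits[of n "\<lambda>k. b (side_index side k) \<omega>" "- int m"] n start by auto
        then show ?thesis by blast
      qed
    qed
  qed
qed

lemma AE_regular_bridge: "AE \<omega> in M. regular_bridge (\<lambda>i. b i \<omega>) (\<lambda>i. T i \<omega>)"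
  using AE_trees AE_hits[of False] AE_hits[of True] AE_steps[of False] AE_steps[of True] AE_space
proof eventually_elim
  case (elim \<omega>)
  show ?case
  proof
    show "b 0 \<omega> = 0" using elim(6) by (rule b_0)
    show "\<bar>b (i + 1) \<omega> - b i \<omega>\<bar> = 1" for i
    proof (cases "0 \<le> i")
      case True
      then obtain n where "i = int n" by (rule nonneg_int_cases)
      then show ?thesis using elim(4)[rule_format, of n] by (simp add: side_index_def add.commute)
    next
      case False
      define n where "n = nat (- i - 1)"
      have "side_index True (Suc n) = i" "side_index True n = i + 1"
        using False by (auto simp: n_def side_index_def)
      then show ?thesis using elim(5)[rule_format, of n] by (simp add: abs_minus_commute)
    qed
    show "\<exists>n. b (int n) \<omega> = - int m" for m using elim(2) by (simp add: side_index_def)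
    show "\<exists>n. b (- int n) \<omega> = - int m" for m using elim(3) by (simp add: side_index_def)
  qed (use elim(1) in auto)
qed

text \<open>The finite-horizon version of contact at all times in \<open>js\<close>: a path of
  length \<open>N\<close> decides which trees are constrained.\<close>

definition open_until :: "bool \<Rightarrow> nat list \<Rightarrow> nat \<Rightarrow> 'a set" where
  "open_until side js N = {\<omega> \<in> space M. \<forall>n<N. \<forall>j\<in>set js.
     tree_index side n \<in> down_steps (\<lambda>i. b i \<omega>) \<and> (\<forall>t\<le>n. - int j < b (side_index side t) \<omega>) \<longrightarrow>
     T (tree_index side n) \<omega> \<in> labels_above (- int j)}"

lemma open_until_measurable [measurable]: "open_until side js N \<in> events"
  unfolding open_until_def by measurable

text \<open>For a fixed path the constraints concern distinct trees with known root labels, so the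
  event has the path weight as its probability.\<close>

lemma prob_open_until:
  assumes "sorted_wrt (<) js"
  shows "prob (open_until side js N) = (\<Sum>w | length w = N. path_weight (step_factor side js) w)"
proof -
  have "prob (open_until side js N) =
      (\<Sum>w | length w = N. prob ({\<omega> \<in> space M. follows (\<lambda>n. b (side_index side n) \<omega>) w} \<inter> open_until side js N))"
    by (rule prob_eq_sum_paths) measurable
  also have "\<dots> = (\<Sum>w | length w = N. path_weight (step_factor side js) w)"
  proof (rule sum.cong)
    fix w :: "bool list" assume "w \<in> {w. length w = N}"
    then have len: "length w = N" by simp
    let ?F = "{\<omega> \<in> space M. follows (\<lambda>n. b (side_index side n) \<omega>) w}"
    let ?C = "{\<omega> \<in> space M. \<forall>n\<in>constrained side js w. T (tree_index side n) \<omega> \<in> labels_above (- int (target js w n))}"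
    have "?F \<inter> open_until side js N = ?F \<inter> ?C"
    proof -
      have "\<omega> \<in> open_until side js N \<longleftrightarrow> \<omega> \<in> ?C" if "\<omega> \<in> ?F" for \<omega>
        using constraints_iff[of "\<lambda>n. b (side_index side n) \<omega>" w js
            "{n. tree_index side n \<in> down_steps (\<lambda>i. b i \<omega>)}" side "\<lambda>n. T (tree_index side n) \<omega>"]
          that assms b_0
        by (simp add: open_until_def len tree_index_down_step side_index_def[of side 0])
      then show ?thesis by blast
    qed
    then have "prob (?F \<inter> open_until side js N) = prob (?F \<inter> ?C)" by simp
    also have "\<dots> = prob ?F * (\<Prod>n\<in>constrained side js w. measure (rho (tree_height w n)) (labels_above (- int (target js w n))))"
    proof (rule prob_trees_given_bridge)
      show "inj_on (tree_index side) (constrained side js w)"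
        by (rule inj_onI) (auto simp: tree_index_def split: if_splits)
      show "tree_index side k \<in> down_steps (\<lambda>i. b i \<omega>) \<and> b (tree_index side k) \<omega> = tree_height w k"
        if "\<omega> \<in> ?F" "k \<in> constrained side js w" for \<omega> k
        using constrained_down_step[of "\<lambda>i. b i \<omega>"] that b_0 by auto
    qed (rule finite_constrained follows_event)+
    also have "\<dots> = path_weight (step_factor side js) w"
      unfolding path_weight_eq_prod prob_follows
      using constrained_target by (intro arg_cong2[where f = "(*)"] prod.cong refl) (auto simp: rho_labels_above less_imp_le)
    finally show "prob (?F \<inter> open_until side js N) = path_weight (step_factor side js) w" .
  qed simp
  finally show ?thesis .
qed

text \<open>Up to a null set the event is the decreasing intersection of its finite-horizon
  versions, whose probabilities have a known limit.\<close>

lemma prob_contact_times: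
  assumes "sorted_wrt (<) js" "0 \<notin> set js"
  shows "prob {\<omega> \<in> space M. set js \<subseteq> contact_times side (\<lambda>i. b i \<omega>) (\<lambda>i. T i \<omega>)} = gap_prod (hit_prob side) 0 js"
proof -
  have "(\<lambda>N. prob (open_until side js N)) \<longlonglongrightarrow> prob (\<Inter>N. open_until side js N)"
    by (rule finite_Lim_measure_decseq) (auto simp: decseq_def open_until_def)
  moreover have "(\<lambda>N. prob (open_until side js N)) \<longlonglongrightarrow> gap_prod (hit_prob side) 0 js"
    unfolding prob_open_until[OF assms(1)] by (rule sum_path_weight_tendsto[OF assms])
  ultimately have "prob (\<Inter>N. open_until side js N) = gap_prod (hit_prob side) 0 js"
    by (rule LIMSEQ_unique)
  moreover have "prob {\<omega> \<in> space M. set js \<subseteq> contact_times side (\<lambda>i. b i \<omega>) (\<lambda>i. T i \<omega>)}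
      = prob (\<Inter>N. open_until side js N)"
  proof (rule finite_measure_eq_AE)
    show "AE \<omega> in M. \<omega> \<in> {\<omega> \<in> space M. set js \<subseteq> contact_times side (\<lambda>i. b i \<omega>) (\<lambda>i. T i \<omega>)} \<longleftrightarrow>
        \<omega> \<in> (\<Inter>N. open_until side js N)"
      using AE_regular_bridge AE_space
    proof eventually_elim
      case (elim \<omega>)
      interpret regular_bridge "\<lambda>i. b i \<omega>" "\<lambda>i. T i \<omega>" by (rule elim(1))
      let ?C = "\<lambda>n j. tree_index side n \<in> down_steps (\<lambda>i. b i \<omega>) \<and>
          (\<forall>t\<le>n. - int j < b (side_index side t) \<omega>) \<longrightarrow>
          T (tree_index side n) \<omega> \<in> labels_above (- int j)"
      have "set js \<subseteq> contact_times side (\<lambda>i. b i \<omega>) (\<lambda>i. T i \<omega>) \<longleftrightarrow> (\<forall>j\<in>set js. \<forall>n. ?C n j)"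
      proof -
        have "j \<in> contact_times side (\<lambda>i. b i \<omega>) (\<lambda>i. T i \<omega>) \<longleftrightarrow> (\<forall>n. ?C n j)" if "j \<in> set js" for j
          using that assms(2) by (intro contact_times_iff) (auto intro: gr0I)
        then show ?thesis by blast
      qed
      moreover have "\<omega> \<in> (\<Inter>N. open_until side js N) \<longleftrightarrow> (\<forall>N. \<forall>n<N. \<forall>j\<in>set js. ?C n j)"
        using elim(2) by (simp add: open_until_def)
      moreover have "(\<forall>N. \<forall>n<N. \<forall>j\<in>set js. ?C n j) \<longleftrightarrow> (\<forall>j\<in>set js. \<forall>n. ?C n j)"
        by (meson lessI)
      ultimately show ?case using elim(2) by simp
    qed
    have "{\<omega> \<in> space M. \<forall>j\<in>set js. j \<in> contact_times side (\<lambda>i. b i \<omega>) (\<lambda>i. T i \<omega>)} \<in> events"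
      by (rule sets.sets_Collect_finite_All) (auto simp: contact_times_event)
    then show "{\<omega> \<in> space M. set js \<subseteq> contact_times side (\<lambda>i. b i \<omega>) (\<lambda>i. T i \<omega>)} \<in> events"
      by (simp only: subset_eq)
    show "(\<Inter>N. open_until side js N) \<in> events"
      by (rule sets.countable_INT) auto
  qed
  ultimately show ?thesis by simp
qed

lemma renewal_contact_times:
  "renewal_set M (\<lambda>\<omega>. contact_times side (\<lambda>i. b i \<omega>) (\<lambda>i. T i \<omega>)) (hit_prob side)"
  by unfold_locales (auto simp: contact_times_event prob_contact_times)

lemma contact_times_laws:
  "0 < j \<Longrightarrow> prob {\<omega> \<in> space M. j \<in> contact_times side (\<lambda>i. b i \<omega>) (\<lambda>i. T i \<omega>)} = hit_prob side (int j)"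
  "AE \<omega> in M. infinite (contact_times side (\<lambda>i. b i \<omega>) (\<lambda>i. T i \<omega>))"
  "AE \<omega> in M. has_frequency (contact_times side (\<lambda>i. b i \<omega>) (\<lambda>i. T i \<omega>)) 0"
proof -
  interpret R: renewal_set M "\<lambda>\<omega>. contact_times side (\<lambda>i. b i \<omega>) (\<lambda>i. T i \<omega>)" "hit_prob side"
    by (rule renewal_contact_times)
  show "0 < j \<Longrightarrow> prob {\<omega> \<in> space M. j \<in> contact_times side (\<lambda>i. b i \<omega>) (\<lambda>i. T i \<omega>)} = hit_prob side (int j)"
    by (rule R.prob_mem)
  show "AE \<omega> in M. infinite (contact_times side (\<lambda>i. b i \<omega>) (\<lambda>i. T i \<omega>))"
  proof (rule R.AE_infinite)
    show "0 \<le> hit_prob side (int j)" for j by (simp add: hit_prob_def)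
    \<comment> \<open>Both functions dominate \<open>1 / (j + 1)\<close>, on the left because
      \<open>j + 3 \<le> 3 * (j + 1)\<close>, so one harmonic comparison serves both sides.\<close>
    have ge: "norm (inverse (real (Suc j))) \<le> hit_prob side (int j)" for j
    proof (cases side)
      case True
      have "1 / (real j + 1) = (3 * 1) / (3 * (real j + 1))"
        by (rule mult_divide_mult_cancel_left[symmetric]) simp
      also have "\<dots> \<le> 3 / (real j + 3)" by (rule frac_le) auto
      finally show ?thesis using True by (simp add: hit_prob_def inverse_eq_divide add.commute)
    qed (simp add: hit_prob_def inverse_eq_divide add.commute)
    have "\<not> summable (\<lambda>j. inverse (real (Suc j)))"
      using not_summable_harmonic[where 'a = real] summable_Suc_iff[of "\<lambda>j. inverse (real j)"] by simp
    moreover have "summable (\<lambda>j. inverse (real (Suc j)))" if "summable (\<lambda>j. hit_prob side (int j))"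
      by (rule summable_comparison_test[OF _ that]) (intro exI allI impI ge)
    ultimately show "\<not> summable (\<lambda>j. hit_prob side (int j))" by blast
  qed
  show "AE \<omega> in M. has_frequency (contact_times side (\<lambda>i. b i \<omega>) (\<lambda>i. T i \<omega>)) 0"
  proof (rule R.AE_frequency_0[where C = 3])
    fix j :: nat assume "0 < j"
    then have "3 / (real j + 3) \<le> 3 / real j" "1 / (real j + 1) \<le> 3 / real j"
      by (auto intro!: divide_left_mono frac_le)
    then show "hit_prob side (int j) \<le> 3 / real j" by (simp add: hit_prob_def)
  qed
qed

end

theorem proposition2:
  fixes M :: "'a measure" and b :: "int \<Rightarrow> 'a \<Rightarrow> int" and T :: "int \<Rightarrow> 'a \<Rightarrow> ltree"
  assumes "treed_bridge M b T"
  shows "(\<forall>i::nat. i \<ge> 1 \<longrightarrow>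
           measure M {\<omega>\<in>space M. i \<in> R_plus (\<lambda>k. b k \<omega>) (\<lambda>k. T k \<omega>)} = 1 / (real i + 1) \<and>
           measure M {\<omega>\<in>space M. i \<in> R_minus (\<lambda>k. b k \<omega>) (\<lambda>k. T k \<omega>)} = 3 / (real i + 3)) \<and>
         (AE \<omega> in M. infinite (R_plus (\<lambda>k. b k \<omega>) (\<lambda>k. T k \<omega>)) \<and>
                     infinite (R_minus (\<lambda>k. b k \<omega>) (\<lambda>k. T k \<omega>))) \<and>
         (AE \<omega> in M.
           (\<exists>\<^sub>\<infinity>j. max_geodesic (\<lambda>k. b k \<omega>) (\<lambda>k. T k \<omega>) j \<in> left_boundary (\<lambda>k. b k \<omega>) (\<lambda>k. T k \<omega>)) \<and>
           (\<exists>\<^sub>\<infinity>j. max_geodesic (\<lambda>k. b k \<omega>) (\<lambda>k. T k \<omega>) j \<in> right_boundary (\<lambda>k. b k \<omega>) (\<lambda>k. T k \<omega>))) \<and>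
         (AE \<omega> in M. has_frequency (R_plus (\<lambda>k. b k \<omega>) (\<lambda>k. T k \<omega>)) 0 \<and>
                     has_frequency (R_minus (\<lambda>k. b k \<omega>) (\<lambda>k. T k \<omega>)) 0)"
proof -
  interpret treed_bridge M b T by (rule assms)
  have inf: "AE \<omega> in M. infinite (R_plus (\<lambda>k. b k \<omega>) (\<lambda>k. T k \<omega>)) \<and>
      infinite (R_minus (\<lambda>k. b k \<omega>) (\<lambda>k. T k \<omega>))"
    using contact_times_laws(2)[of False] contact_times_laws(2)[of True]
    by eventually_elim (simp add: contact_times_def)
  have "AE \<omega> in M.
      (\<exists>\<^sub>\<infinity>j. max_geodesic (\<lambda>k. b k \<omega>) (\<lambda>k. T k \<omega>) j \<in> left_boundary (\<lambda>k. b k \<omega>) (\<lambda>k. T k \<omega>)) \<and>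
      (\<exists>\<^sub>\<infinity>j. max_geodesic (\<lambda>k. b k \<omega>) (\<lambda>k. T k \<omega>) j \<in> right_boundary (\<lambda>k. b k \<omega>) (\<lambda>k. T k \<omega>))"
    using inf by eventually_elim (simp add: frequently_cofinite R_plus_def R_minus_def)
  moreover have "AE \<omega> in M. has_frequency (R_plus (\<lambda>k. b k \<omega>) (\<lambda>k. T k \<omega>)) 0 \<and>
      has_frequency (R_minus (\<lambda>k. b k \<omega>) (\<lambda>k. T k \<omega>)) 0"
    using contact_times_laws(3)[of False] contact_times_laws(3)[of True]
    by eventually_elim (simp add: contact_times_def)
  moreover have "\<forall>i::nat. i \<ge> 1 \<longrightarrow>
      measure M {\<omega>\<in>space M. i \<in> R_plus (\<lambda>k. b k \<omega>) (\<lambda>k. T k \<omega>)} = 1 / (real i + 1) \<and>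
      measure M {\<omega>\<in>space M. i \<in> R_minus (\<lambda>k. b k \<omega>) (\<lambda>k. T k \<omega>)} = 3 / (real i + 3)"
    using contact_times_laws(1)[of _ False] contact_times_laws(1)[of _ True]
    by (simp add: contact_times_def hit_prob_def)
  ultimately show ?thesis using inf by blast
qed

end
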